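(* Let $N\ge 1$, and let $\beta>0$, $c_f>0$, $c_a>0$, $p_n>0$ with $\sum_{n=1}^N p_n=1$, and $\lambda_n>0$ for $n=1,\dots,N$. Consider the pull-based caching problem: minimize, over all admissible pull-based policies $\boldsymbol u=(u_n)_{n=1}^N$, the long-run average cost $$\limsup_{T\to\infty}\frac1T\,\mathbb E\Big[\sum_{n=1}^N\Big(c_f\,K_n(T)+\sum_{t\le T:\ r_n(t)=1}\lambda_n c_a\,s_n(t)\,(1-u_n(t))\Big)\Big],$$ where $K_n(T)$ is the number of fetches of item $n$ in $[0,T]$, $r_n(t)=1$ iff a request for item $n$ arrives at time $t$, $u_n(t)=1$ iff item $n$ is fetched at time $t$, and $s_n(t)$ is the time elapsed since the last fetch of item $n$. Let $$\tau_n^*=\frac1{\beta p_n}\left(\sqrt{1+\frac{2\beta p_n c_f}{c_a\lambda_n}}-1\right).$$ Then the policy $$u_n^*(s_n,r_n)=\begin{cases}r_n,& s_n>\tau_n^*,\\ 0,& s_n\le\tau_n^*,\end{cases}$$ (fetch item $n$ exactly when a request for it arrives and more than $\tau_n^*$ time has elapsed since its last fetch) solves this minimization problem, and the optimal average cost is $$C^{E^*}(\boldsymbol\lambda,\beta,\mathbf p)=\sum_{n=1}^N c_a\lambda_n\left(\sqrt{1+\frac{2\beta p_n}{\lambda_n}\frac{c_f}{c_a}}-1\right).$$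
   Context: Model: $N$ data items are stored at a back-end database and copies are kept in a local edge-cache (with room for all items). Time is continuous. Requests for item $n$ arrive at the cache as a Poisson process of rate $\beta p_n$, independently across $n$. Item $n$ is updated at the database at the jump times of an independent Poisson process of rate $\lambda_n$. The cached copy's age is the number of updates since its last fetch. Each fetch of an item into the cache costs $c_f$. A request served from the cache (no fetch at that time) costs $c_a$ times the age. A request at whose arrival time the item is fetched incurs only $c_f$. Pull-based: the controller (the edge-cache) observes request arrival times but not the ages, so the aging cost of a request is replaced by its expectation $\lambda_n c_a s_n(t)$, where $s_n(t)\ge0$ is the time since the most recent fetch of item $n$ strictly before $t$ (with $s_n(0)=0$; it grows at unit rate and is reset to $0$ by a fetch). An admissible pull-based policy chooses fetch times non-anticipatively from the history of the request processes (including a request arriving at the current time) and of its own past actions, with finitely many fetches in every bounded time interval. *)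

theory Defs
  imports "HOL-Probability.Probability"
begin

text \<open>
  A point process on the positive half-line is given by its random set of points
  \<open>A \<omega>\<close>; its counting process is \<open>t \<mapsto> card (A \<omega> \<inter> {..t})\<close>. Since the points form a set,
  the counting process has unit jumps.
\<close>

definition poisson_process :: "'a measure \<Rightarrow> real \<Rightarrow> ('a \<Rightarrow> real set) \<Rightarrow> bool" where
  "poisson_process M rate A \<longleftrightarrow>
     (\<forall>\<omega>\<in>space M. A \<omega> \<subseteq> {0<..} \<and> (\<forall>T. finite (A \<omega> \<inter> {..T}))) \<and>
     (\<forall>s t. 0 \<le> s \<longrightarrow> s < t \<longrightarrow>
        distr M (count_space UNIV) (\<lambda>\<omega>. card (A \<omega> \<inter> {s<..t})) =
        measure_pmf (poisson_pmf (rate * (t - s)))) \<and>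
     (\<forall>\<tau> :: nat \<Rightarrow> real. 0 \<le> \<tau> 0 \<longrightarrow> mono \<tau> \<longrightarrow>
        prob_space.indep_vars M (\<lambda>_. count_space UNIV)
          (\<lambda>i \<omega>. card (A \<omega> \<inter> {\<tau> i<..\<tau> (Suc i)})) UNIV)"

text \<open>
  \<open>A n \<omega>\<close> is the set of arrival times of requests for item \<open>n\<close>. Independence across items is
  independence of the whole counting processes, as random elements of a product space.
\<close>

definition request_processes ::
    "'a measure \<Rightarrow> nat \<Rightarrow> real \<Rightarrow> (nat \<Rightarrow> real) \<Rightarrow> (nat \<Rightarrow> 'a \<Rightarrow> real set) \<Rightarrow> bool" where
  "request_processes M N \<beta> p A \<longleftrightarrow>
     (\<forall>n\<in>{1..N}. poisson_process M (\<beta> * p n) (A n)) \<and>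
     prob_space.indep_vars M (\<lambda>_. PiM {0..} (\<lambda>_. count_space UNIV))
       (\<lambda>n \<omega>. \<lambda>t\<in>{0..}. card (A n \<omega> \<inter> {..t})) {1..N}"

text \<open>
  The \<open>\<sigma>\<close>-algebra generated by the requests for all items on \<open>[0,t]\<close>, time \<open>t\<close> included.
\<close>

definition request_history ::
    "'a measure \<Rightarrow> nat \<Rightarrow> (nat \<Rightarrow> 'a \<Rightarrow> real set) \<Rightarrow> real \<Rightarrow> 'a measure" where
  "request_history M N A t =
     vimage_algebra (space M)
       (\<lambda>\<omega>. \<lambda>(n, s)\<in>{1..N} \<times> {0..t}. card (A n \<omega> \<inter> {..s}))
       (PiM ({1..N} \<times> {0..t}) (\<lambda>_. count_space UNIV))"

text \<open>
  A policy is a process \<open>u n t \<omega>\<close>, true iff item \<open>n\<close> is fetched at time \<open>t\<close>. Only times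
  \<open>t \<ge> 0\<close> matter.
\<close>

type_synonym 'a policy = "nat \<Rightarrow> real \<Rightarrow> 'a \<Rightarrow> bool"

definition fetch_count :: "'a policy \<Rightarrow> nat \<Rightarrow> real \<Rightarrow> 'a \<Rightarrow> nat" where
  "fetch_count u n T \<omega> = card {t\<in>{0..T}. u n t \<omega>}"

text \<open>
  Time since the most recent fetch strictly before \<open>t\<close>; the clock starts at \<open>0\<close> at time \<open>0\<close>.
  The maximum exists because fetch times do not accumulate under the policies considered.
\<close>

definition since_fetch :: "'a policy \<Rightarrow> nat \<Rightarrow> real \<Rightarrow> 'a \<Rightarrow> real" where
  "since_fetch u n t \<omega> = t - Max (insert 0 {x\<in>{0..<t}. u n x \<omega>})"

text \<open>
  Non-anticipation is adaptedness of the fetch counts to the history of requests. The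
  policy's own past actions add no information to that history: if the decision at \<open>t\<close> is a
  function of the requests on \<open>[0,t]\<close> and of the fetches on \<open>[0,t)\<close>, and the fetch times are
  locally finite, then the fetches on \<open>[0,t]\<close> are determined by the requests on \<open>[0,t]\<close>
  (compare two fetch patterns at the first time where they differ).
\<close>

definition admissible ::
    "'a measure \<Rightarrow> nat \<Rightarrow> (nat \<Rightarrow> 'a \<Rightarrow> real set) \<Rightarrow> 'a policy \<Rightarrow> bool" where
  "admissible M N A u \<longleftrightarrow>
     (\<forall>n\<in>{1..N}.
        (\<forall>\<omega>\<in>space M. \<forall>T. finite {t\<in>{0..T}. u n t \<omega>}) \<and>
        (\<forall>t\<ge>0. fetch_count u n t \<in> measurable (request_history M N A t) (count_space UNIV)))"

definition total_cost ::
    "nat \<Rightarrow> real \<Rightarrow> real \<Rightarrow> (nat \<Rightarrow> real) \<Rightarrow> (nat \<Rightarrow> 'a \<Rightarrow> real set) \<Rightarrow> 'a policy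
      \<Rightarrow> real \<Rightarrow> 'a \<Rightarrow> real" where
  "total_cost N cf ca lam A u T \<omega> =
     (\<Sum>n = 1..N. cf * real (fetch_count u n T \<omega>) +
        (\<Sum>t \<in> A n \<omega> \<inter> {..T}. lam n * ca * since_fetch u n t \<omega> * (1 - of_bool (u n t \<omega>))))"

text \<open>
  The expected cost may be infinite, hence the extended nonnegative integral.
\<close>

definition average_cost ::
    "'a measure \<Rightarrow> nat \<Rightarrow> real \<Rightarrow> real \<Rightarrow> (nat \<Rightarrow> real) \<Rightarrow> (nat \<Rightarrow> 'a \<Rightarrow> real set)
      \<Rightarrow> 'a policy \<Rightarrow> ennreal" where
  "average_cost M N cf ca lam A u =
     Limsup at_top (\<lambda>T :: real.
       ennreal (1 / T) * (\<integral>\<^sup>+\<omega>. ennreal (total_cost N cf ca lam A u T \<omega>) \<partial>M))"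

definition optimal_policy ::
    "'a measure \<Rightarrow> nat \<Rightarrow> real \<Rightarrow> real \<Rightarrow> (nat \<Rightarrow> real) \<Rightarrow> (nat \<Rightarrow> 'a \<Rightarrow> real set)
      \<Rightarrow> 'a policy \<Rightarrow> bool" where
  "optimal_policy M N cf ca lam A u \<longleftrightarrow>
     admissible M N A u \<and>
     (\<forall>v. admissible M N A v \<longrightarrow>
        average_cost M N cf ca lam A u \<le> average_cost M N cf ca lam A v)"

definition optimal_cost ::
    "'a measure \<Rightarrow> nat \<Rightarrow> real \<Rightarrow> real \<Rightarrow> (nat \<Rightarrow> real) \<Rightarrow> (nat \<Rightarrow> 'a \<Rightarrow> real set) \<Rightarrow> ennreal" where
  "optimal_cost M N cf ca lam A = (INF v\<in>Collect (admissible M N A). average_cost M N cf ca lam A v)"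

definition fetch_threshold ::
    "real \<Rightarrow> (nat \<Rightarrow> real) \<Rightarrow> real \<Rightarrow> real \<Rightarrow> (nat \<Rightarrow> real) \<Rightarrow> nat \<Rightarrow> real" where
  "fetch_threshold \<beta> p cf ca lam n =
     1 / (\<beta> * p n) * (sqrt (1 + 2 * \<beta> * p n * cf / (ca * lam n)) - 1)"

definition threshold_rule :: "(nat \<Rightarrow> real) \<Rightarrow> nat \<Rightarrow> real \<Rightarrow> bool \<Rightarrow> bool" where
  "threshold_rule \<tau> n s r = (if s > \<tau> n then r else False)"

text \<open>
  A feedback rule \<open>\<phi> n s r\<close> prescribes the action from the elapsed time \<open>s\<close> and the request
  indicator \<open>r\<close>. As \<open>s\<close> depends on earlier fetches, the rule is a fixed-point condition on the
  policy rather than an explicit definition of it.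
\<close>

definition follows_rule ::
    "'a measure \<Rightarrow> nat \<Rightarrow> (nat \<Rightarrow> 'a \<Rightarrow> real set) \<Rightarrow> (nat \<Rightarrow> real \<Rightarrow> bool \<Rightarrow> bool) \<Rightarrow> 'a policy \<Rightarrow> bool"
  where
  "follows_rule M N A \<phi> u \<longleftrightarrow>
     (\<forall>n\<in>{1..N}. \<forall>\<omega>\<in>space M. \<forall>t\<ge>0. u n t \<omega> = \<phi> n (since_fetch u n t \<omega>) (t \<in> A n \<omega>))"

end

theory Submission
  imports Defs
begin

text \<open>
  Fix an item with request rate \<open>b\<close>, aging cost \<open>a\<close> per unit of elapsed time, and threshold \<open>\<tau>\<close>;
  the formula for \<open>\<tau>\<close> says exactly that \<open>cf = a b \<tau>\<^sup>2/2 + a \<tau>\<close>. The relative value function of the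
  average-cost problem is \<open>a b V\<close> with \<open>V s = \<tau> m - m\<^sup>2/2\<close>, \<open>m = min s \<tau>\<close>, and the optimality
  equation gives \<open>min (a s) (cf - a b V s) = a m\<close>. Telescoping \<open>V\<close> along a path bounds the
  cost of any policy on \<open>[0,T]\<close> from below by \<open>a b \<tau> T - a b \<tau>\<^sup>2/2 + a D\<close>, and that of the threshold
  policy from above by \<open>a b \<tau> T + a D\<close>. Here \<open>D\<close> is the sum of \<open>m\<close> over the requests minus \<open>b\<close> times
  its time integral. As the age is determined by the strict past, \<open>D\<close> is a limit of left-endpoint sums
  against independent centred Poisson increments, so it has mean zero. Hence \<open>a b \<tau>\<close> is the optimal
  average cost of the item.
\<close>

section \<open>The age of a copy and the cost of a path\<close>

text \<open>The inserted 0 starts the clock at time 0. A fetch at \<open>t\<close> itself is left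
  out, so the age depends on the strict past only.\<close>

definition age :: "real set \<Rightarrow> real \<Rightarrow> real" where
  "age F t = t - Max (insert 0 {x\<in>{0..<t}. x \<in> F})"

lemma since_fetch_age: "since_fetch u n t \<omega> = age {x. u n x \<omega>} t"
  by (simp add: since_fetch_def age_def)

definition locally_finite :: "real set \<Rightarrow> bool" where
  "locally_finite F \<longleftrightarrow> (\<forall>T. finite {t\<in>{0..T}. t \<in> F})"

lemma finite_before:
  assumes "locally_finite F"
  shows "finite {x\<in>{0..<t}. x \<in> F}"
  by (rule finite_subset[of _ "{x\<in>{0..t}. x \<in> F}"]) (use assms in \<open>auto simp: locally_finite_def\<close>)

text \<open>A maximum is at most \<open>y\<close> iff every element is, and the inserted 0 is at
  most \<open>y\<close> by hypothesis. In this form a level set of the age speaks of points of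
  \<open>F\<close> in an interval, which can be counted.\<close>

lemma age_ge_iff:
  assumes "locally_finite F" "0 \<le> y"
  shows "age F t \<ge> t - y \<longleftrightarrow> (\<forall>x\<in>F. 0 \<le> x \<and> x < t \<longrightarrow> x \<le> y)"
  using finite_before[OF assms(1), of t] assms(2) by (auto simp: age_def)

lemma age_le:
  assumes "locally_finite F"
  shows "age F t \<le> t"
  using finite_before[OF assms, of t] by (auto simp: age_def)

lemma age_nonneg:
  assumes "locally_finite F" "0 \<le> t"
  shows "0 \<le> age F t"
  using age_ge_iff[OF assms, of t] by auto

lemma age_0: "locally_finite F \<Longrightarrow> age F 0 = 0"
  using age_le[of F 0] age_nonneg[of F 0] by simp

text \<open>The fetch-free interval is closed on the left, because a fetch at \<open>y\<close> is
  invisible to the age at \<open>y\<close> but resets the age seen at a later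
  \<open>x\<close>.\<close>

lemma age_shift:
  assumes "0 \<le> y" "y \<le> x" "\<And>f. f \<in> F \<Longrightarrow> y \<le> f \<Longrightarrow> f < x \<Longrightarrow> False"
  shows "age F x = age F y + (x - y)"
proof -
  have "{z\<in>{0..<x}. z \<in> F} = {z\<in>{0..<y}. z \<in> F}"
    using assms by force
  then show ?thesis by (simp add: age_def)
qed

text \<open>\<open>f\<close> is the start of the current cycle: the last fetch strictly before
  \<open>t\<close>, or 0 when there is none. Equality with \<open>t\<close> can occur only at time
  0.\<close>

lemma age_last:
  assumes "locally_finite F" "0 \<le> t"
  obtains f where "f = 0 \<or> f \<in> F" "0 \<le> f" "f \<le> t" "age F t = t - f" "f = 0 \<or> f < t"
    "\<And>g. g \<in> F \<Longrightarrow> 0 \<le> g \<Longrightarrow> g < t \<Longrightarrow> g \<le> f"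
proof -
  let ?S = "insert 0 {x\<in>{0..<t}. x \<in> F}"
  have fin: "finite ?S" using finite_before[OF assms(1)] by auto
  have in_S: "Max ?S \<in> ?S" using fin by (intro Max_in) auto
  show ?thesis
  proof (rule that[of "Max ?S"])
    show "Max ?S = 0 \<or> Max ?S \<in> F" "0 \<le> Max ?S" "Max ?S \<le> t" "Max ?S = 0 \<or> Max ?S < t"
      using in_S assms(2) by auto
    show "age F t = t - Max ?S" by (simp add: age_def)
    show "g \<le> Max ?S" if "g \<in> F" "0 \<le> g" "g < t" for g
      using fin that by (intro Max_ge) auto
  qed
qed

text \<open>Beyond the last fetch strictly before \<open>x\<close> the age is linear up to and
  including \<open>x\<close>, as a fetch at \<open>x\<close> does not count yet. This
  left-continuity makes left-endpoint sums converge later.\<close>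

lemma age_left_lim:
  assumes "locally_finite F" "0 < x" "\<And>m. 0 \<le> y m" "\<And>m. y m < x" "y \<longlonglongrightarrow> x"
  shows "(\<lambda>m. age F (y m)) \<longlonglongrightarrow> age F x"
proof -
  obtain f where f: "f < x" "age F x = x - f" "\<And>g. g \<in> F \<Longrightarrow> 0 \<le> g \<Longrightarrow> g < x \<Longrightarrow> g \<le> f"
    using age_last[OF assms(1), of x] assms(2) by (metis less_eq_real_def)
  have ev: "\<forall>\<^sub>F m in sequentially. y m > f" using order_tendstoD(1)[OF assms(5) f(1)] .
  have "\<forall>\<^sub>F m in sequentially. age F (y m) = age F x - (x - y m)"
    using ev
  proof eventually_elim
    case (elim m)
    have "age F x = age F (y m) + (x - y m)"
    proof (rule age_shift)
      show "False" if "g \<in> F" "y m \<le> g" "g < x" for g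
        using f(3)[OF that(1)] that assms(3)[of m] elim by auto
    qed (use assms(3,4)[of m] in auto)
    then show ?case by simp
  qed
  moreover have "(\<lambda>m. age F x - (x - y m)) \<longlonglongrightarrow> age F x - (x - x)"
    by (intro tendsto_intros assms)
  ultimately show ?thesis by (simp add: tendsto_cong)
qed

section \<open>The relative value function and its telescoping identity\<close>

definition relative_value :: "real \<Rightarrow> real \<Rightarrow> real" where
  "relative_value \<tau> s = \<tau> * min s \<tau> - (min s \<tau>)\<^sup>2 / 2"

lemma relative_value_le: "relative_value \<tau> s \<le> \<tau>\<^sup>2 / 2"
  using zero_le_power2[of "\<tau> - min s \<tau>"]
  by (simp add: relative_value_def power2_diff)

lemma relative_value_nonneg:
  assumes "0 \<le> s" "0 \<le> \<tau>"
  shows "0 \<le> relative_value \<tau> s"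
proof -
  have "min s \<tau> * min s \<tau> \<le> min s \<tau> * \<tau>"
    using assms by (intro mult_left_mono) auto
  moreover have "0 \<le> \<tau> * min s \<tau>" using assms by auto
  ultimately show ?thesis by (simp add: relative_value_def power2_eq_square mult.commute)
qed

text \<open>On the positive half-line \<open>relative_value \<tau>\<close> has derivative \<tau> -
  min s \<tau> and starts at 0; the identity is the integrated form. The interval is split at
  \<tau>, after which the integrand is constant.\<close>

lemma has_integral_min:
  assumes "0 \<le> d" "0 \<le> \<tau>"
  shows "((\<lambda>s. min s \<tau>) has_integral \<tau> * d - relative_value \<tau> d) {0..d}"
proof -
  have *: "((\<lambda>s. min s \<tau>) has_integral e\<^sup>2 / 2) {0..e}" if "0 \<le> e" "e \<le> \<tau>" for e
  proof -
    have "((\<lambda>s. s) has_integral (e\<^sup>2 / 2 - 0\<^sup>2 / 2)) {0..e}"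
      by (rule fundamental_theorem_of_calculus)
         (use that in \<open>auto intro!: derivative_eq_intros
            simp: has_real_derivative_iff_has_vector_derivative[symmetric]\<close>)
    then have "((\<lambda>s. s) has_integral e\<^sup>2 / 2) {0..e}" by simp
    then show ?thesis
      by (rule has_integral_eq[rotated]) (use that in auto)
  qed
  show ?thesis
  proof (cases "d \<le> \<tau>")
    case True
    then show ?thesis using *[OF assms(1) True]
      by (simp add: relative_value_def)
  next
    case False
    have "((\<lambda>s. \<tau>) has_integral (d - \<tau>) * \<tau>) {\<tau>..d}"
      using has_integral_const_real[of \<tau> \<tau> d] False by simp
    then have "((\<lambda>s. min s \<tau>) has_integral (d - \<tau>) * \<tau>) {\<tau>..d}"
      by (rule has_integral_eq[rotated]) auto
    from has_integral_combine[OF _ _ *[OF assms(2)] this] False assms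
    show ?thesis by (simp add: relative_value_def power2_eq_square algebra_simps)
  qed
qed

text \<open>On each cycle the age grows from 0 at unit rate, so a cycle of length d contributes
  \<tau> d minus the relative value of d, and d is the age at which the cycle ends. The cycle
  running at \<open>T\<close> has its own term, hence the half-open range of the sum. Cutting at the
  last fetch before \<open>T\<close> lowers the number of fetches.\<close>

lemma has_integral_min_age:
  assumes "locally_finite F" "0 \<le> \<tau>" "0 \<le> T"
  shows "((\<lambda>t. min (age F t) \<tau>) has_integral
    \<tau> * T - relative_value \<tau> (age F T) - (\<Sum>f\<in>{x\<in>{0..<T}. x \<in> F}. relative_value \<tau> (age F f))) {0..T}"
  using assms(3)
proof (induction "card {x\<in>{0..<T}. x \<in> F}" arbitrary: T rule: less_induct)
  case less
  let ?S = "\<lambda>T. {x\<in>{0..<T}. x \<in> F}"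
  let ?I = "\<lambda>T. \<tau> * T - relative_value \<tau> (age F T) - (\<Sum>f\<in>?S T. relative_value \<tau> (age F f))"
  obtain f where f: "f = 0 \<or> f \<in> F" "0 \<le> f" "f \<le> T" "age F T = T - f" "f = 0 \<or> f < T"
    "\<And>g. g \<in> F \<Longrightarrow> 0 \<le> g \<Longrightarrow> g < T \<Longrightarrow> g \<le> f"
    using age_last[OF assms(1) less.prems] by blast
  have age_eq: "age F t = t - f" if "f < t" "t \<le> T" for t
    using age_shift[of t T F] f(2,4,6) that by force
  have "((\<lambda>s. min s \<tau>) has_integral \<tau> * (T - f) - relative_value \<tau> (T - f)) {0..T - f}"
    using f(3) assms(2) by (intro has_integral_min) auto
  then have "((\<lambda>s. min (s - f) \<tau>) has_integral \<tau> * (T - f) - relative_value \<tau> (T - f)) {f..T}"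
    using has_integral_affinity'[of "\<lambda>s. min s \<tau>" _ 0 "T - f" 1 "-f"] by simp
  \<comment> \<open>At \<open>f\<close> itself the age still has its value before the reset, hence
    the exceptional point.\<close>
  then have 1: "((\<lambda>t. min (age F t) \<tau>) has_integral \<tau> * (T - f) - relative_value \<tau> (T - f)) {f..T}"
    by (rule has_integral_spike_finite[of "{f}", rotated 2]) (auto simp: age_eq)
  show ?case
  proof (cases "f = 0")
    case True
    \<comment> \<open>When the cycle starts at 0, the only fetch that can precede \<open>T\<close>
      is one at time 0, where the age vanishes.\<close>
    have "(\<Sum>g\<in>?S T. relative_value \<tau> (age F g)) = 0"
    proof (rule sum.neutral, safe)
      fix g assume "g \<in> F" "g \<in> {0..<T}"
      then have "g = 0" using f(6)[of g] True by auto
      then show "relative_value \<tau> (age F g) = 0"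
        using age_0[OF assms(1)] assms(2) by (simp add: relative_value_def)
    qed
    then show ?thesis using 1 True f(4) by simp
  next
    case False
    then have fF: "f \<in> F" "f < T" using f(1,5) by auto
    have S: "?S T = insert f (?S f)" using fF f(2,6) by force
    have nin: "f \<notin> ?S f" by auto
    have "card (?S f) < card (?S T)"
      unfolding S using finite_before[OF assms(1), of f] nin by (simp add: card_insert_disjoint)
    from less.hyps[OF this f(2)] have 0: "((\<lambda>t. min (age F t) \<tau>) has_integral ?I f) {0..f}" .
    have sum_S: "(\<Sum>g\<in>?S T. relative_value \<tau> (age F g)) =
        relative_value \<tau> (age F f) + (\<Sum>g\<in>?S f. relative_value \<tau> (age F g))"
      unfolding S by (rule sum.insert[OF finite_before[OF assms(1)] nin])
    show ?thesis
      using has_integral_combine[OF f(2,3) 0 1] unfolding f(4) sum_S by (simp add: algebra_simps)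
  qed
qed

text \<open>The stochastic integral of the truncated age against the compensated counting process of
  requests, written along one path.\<close>

definition compensated_requests :: "real \<Rightarrow> real \<Rightarrow> real set \<Rightarrow> real set \<Rightarrow> real \<Rightarrow> real" where
  "compensated_requests b \<tau> A F T =
     (\<Sum>t\<in>A \<inter> {..T}. min (age F t) \<tau>) - b * integral {0..T} (\<lambda>t. min (age F t) \<tau>)"

definition path_cost :: "real \<Rightarrow> real \<Rightarrow> real set \<Rightarrow> real set \<Rightarrow> real \<Rightarrow> real" where
  "path_cost cf a A F T = cf * real (card {t\<in>{0..T}. t \<in> F}) +
     (\<Sum>t\<in>A \<inter> {..T}. a * age F t * (1 - of_bool (t \<in> F)))"

text \<open>Let V be the relative value and m the truncated age. A served request costs at least a
  m, and a fetch costs \<open>cf\<close>, which is at least a b V + a m because V is at most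
  \<tau>^2/2 and m at most \<tau>. Telescoping turns the sum of V over the fetches into \<tau> T
  minus the time integral of m, up to a boundary term at \<open>T\<close>. Under the threshold rule
  fetches happen at age above \<tau> and services at age at most \<tau>, so the inequalities for
  single events become equalities.\<close>

lemma
  assumes F: "locally_finite F" and A: "A \<subseteq> {0<..}" "finite (A \<inter> {..T})"
    and pos: "0 \<le> T" "0 \<le> a" "0 \<le> b" "0 \<le> \<tau>" and cf: "cf = a * b * \<tau>\<^sup>2 / 2 + a * \<tau>"
  shows path_cost_ge:
      "a * b * \<tau> * T - a * b * \<tau>\<^sup>2 / 2 + a * compensated_requests b \<tau> A F T \<le> path_cost cf a A F T"
    and path_cost_le: "(\<And>t. 0 \<le> t \<Longrightarrow> t \<in> F \<longleftrightarrow> t \<in> A \<and> \<tau> < age F t) \<Longrightarrow>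
      path_cost cf a A F T \<le> a * b * \<tau> * T + a * compensated_requests b \<tau> A F T"
proof -
  define J where "J = integral {0..T} (\<lambda>t. min (age F t) \<tau>)"
  define FT where "FT = {t\<in>{0..T}. t \<in> F}"
  let ?S = "{x\<in>{0..<T}. x \<in> F}" and ?V = "\<lambda>t. relative_value \<tau> (age F t)"
  let ?m = "\<lambda>t. min (age F t) \<tau>"
  have finF: "finite FT" using F by (simp add: locally_finite_def FT_def)
  have J: "J = \<tau> * T - ?V T - sum ?V ?S"
    unfolding J_def using has_integral_min_age[OF F pos(4,1)] by (rule integral_unique)
  have ageT: "0 \<le> age F T" using age_nonneg[OF F pos(1)] .
  have FT_nonneg: "0 \<le> age F t" if "t \<in> FT" for t using that age_nonneg[OF F, of t] by (auto simp: FT_def)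
  have AT_nonneg: "0 \<le> age F t" if "t \<in> A" for t using that A(1) age_nonneg[OF F, of t] by force
  have sub: "?S \<subseteq> FT" by (auto simp: FT_def)
  \<comment> \<open>\<open>FT\<close> may contain a fetch at \<open>T\<close>, which
    \<open>?S\<close> omits. The two bounds bracket its contribution between 0 and
    \<open>?V T\<close>.\<close>
  have V_ge: "sum ?V ?S \<le> sum ?V FT"
    by (rule sum_mono2[OF finF sub]) (use FT_nonneg pos relative_value_nonneg in auto)
  have V_le: "sum ?V FT \<le> sum ?V ?S + ?V T"
  proof -
    have "sum ?V FT \<le> sum ?V (insert T ?S)"
      by (rule sum_mono2) (use finite_before[OF F, of T] pos ageT relative_value_nonneg age_nonneg[OF F] in \<open>auto simp: FT_def\<close>)
    also have "\<dots> = sum ?V ?S + ?V T" using finite_before[OF F, of T] by simp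
    finally show ?thesis .
  qed
  have split_A: "sum g (A \<inter> {..T}) = sum g (A \<inter> {..T} - FT) + sum g (A \<inter> FT)" for g :: "real \<Rightarrow> real"
  proof -
    have "sum g (A \<inter> {..T}) = sum g (A \<inter> {..T} - FT) + sum g (A \<inter> {..T} \<inter> FT)"
      using sum.Int_Diff[OF A(2), of g FT] by simp
    also have "A \<inter> {..T} \<inter> FT = A \<inter> FT" by (auto simp: FT_def)
    finally show ?thesis .
  qed
  have paid: "(\<Sum>t\<in>A \<inter> {..T}. a * age F t * (1 - of_bool (t \<in> F))) = a * (\<Sum>t\<in>A \<inter> {..T} - FT. age F t)"
  proof -
    have "(\<Sum>t\<in>A \<inter> {..T} - FT. a * age F t * (1 - of_bool (t \<in> F))) = (\<Sum>t\<in>A \<inter> {..T} - FT. a * age F t)"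
      by (rule sum.cong) (use A(1) in \<open>auto simp: FT_def of_bool_def\<close>)
    moreover have "(\<Sum>t\<in>A \<inter> FT. a * age F t * (1 - of_bool (t \<in> F))) = 0"
      by (rule sum.neutral) (auto simp: FT_def)
    ultimately show ?thesis by (simp add: split_A sum_distrib_left)
  qed
  have cost: "path_cost cf a A F T = cf * card FT + a * (\<Sum>t\<in>A \<inter> {..T} - FT. age F t)"
    by (simp add: path_cost_def paid FT_def)
  have comp: "compensated_requests b \<tau> A F T =
      sum ?m (A \<inter> {..T} - FT) + sum ?m (A \<inter> FT) - b * J"
    by (simp add: compensated_requests_def J_def split_A)
  have ab: "0 \<le> a * b" using pos by simp
  show "a * b * \<tau> * T - a * b * \<tau>\<^sup>2 / 2 + a * compensated_requests b \<tau> A F T \<le> path_cost cf a A F T"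
  proof -
    \<comment> \<open>Only a fetch at a request replaces a service. A fetch without a request is
      paid for and saves nothing at that moment, so enlarging \<open>A \<inter> FT\<close> to
      \<open>FT\<close> keeps the direction of the estimate.\<close>
    have "a * sum ?m (A \<inter> FT) \<le> a * sum (\<lambda>t. \<tau>) FT"
    proof (intro mult_left_mono pos)
      have "sum ?m (A \<inter> FT) \<le> sum (\<lambda>t. \<tau>) (A \<inter> FT)" by (rule sum_mono) auto
      also have "\<dots> \<le> sum (\<lambda>t. \<tau>) FT" by (rule sum_mono2) (use finF pos in auto)
      finally show "sum ?m (A \<inter> FT) \<le> sum (\<lambda>t. \<tau>) FT" .
    qed
    also have "\<dots> = cf * card FT - a * b * (card FT * (\<tau>\<^sup>2 / 2))"
      by (simp add: cf algebra_simps)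
    also have "\<dots> \<le> cf * card FT - a * b * sum ?V FT"
      using sum_bounded_above[of FT ?V "\<tau>\<^sup>2 / 2"] relative_value_le ab
      by (intro diff_left_mono mult_left_mono) auto
    also have "\<dots> \<le> cf * card FT - a * b * (\<tau> * T - J - \<tau>\<^sup>2 / 2)"
      using J V_ge relative_value_le[of \<tau> "age F T"] by (intro diff_left_mono mult_left_mono ab) auto
    finally have 1: "a * sum ?m (A \<inter> FT) \<le> cf * card FT - a * b * (\<tau> * T - J - \<tau>\<^sup>2 / 2)" .
    have 2: "a * sum ?m (A \<inter> {..T} - FT) \<le> a * (\<Sum>t\<in>A \<inter> {..T} - FT. age F t)"
      by (intro mult_left_mono sum_mono pos) auto
    show ?thesis using 1 2 unfolding cost comp by (simp add: algebra_simps)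
  qed
  assume rule: "\<And>t. 0 \<le> t \<Longrightarrow> t \<in> F \<longleftrightarrow> t \<in> A \<and> \<tau> < age F t"
  show "path_cost cf a A F T \<le> a * b * \<tau> * T + a * compensated_requests b \<tau> A F T"
  proof -
    have FT_sub: "A \<inter> FT = FT" using rule by (auto simp: FT_def)
    have m: "sum ?m FT = \<tau> * card FT"
      using rule by (subst sum.cong[of FT FT ?m "\<lambda>_. \<tau>"]) (auto simp: FT_def)
    have V: "sum ?V FT = \<tau>\<^sup>2 / 2 * card FT"
      using rule by (subst sum.cong[of FT FT ?V "\<lambda>_. \<tau>\<^sup>2 / 2"]) (auto simp: FT_def relative_value_def power2_eq_square)
    have n: "sum ?m (A \<inter> {..T} - FT) = (\<Sum>t\<in>A \<inter> {..T} - FT. age F t)"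
      by (rule sum.cong) (use rule A(1) in \<open>force simp: FT_def\<close>)+
    have "a * b * sum ?V FT \<le> a * b * (\<tau> * T - J)"
      using V_le J by (intro mult_left_mono ab) auto
    then show ?thesis unfolding cost comp n FT_sub m V
      by (simp add: cf algebra_simps)
  qed
qed

section \<open>Poisson increments and the history of requests\<close>

lemma measurable_countable_op2:
  fixes f g :: "'a \<Rightarrow> 'b::countable"
  assumes f: "f \<in> measurable M (count_space UNIV)" and g: "g \<in> measurable M (count_space UNIV)"
  shows "(\<lambda>x. h (f x) (g x)) \<in> measurable M (count_space UNIV)"
  by (rule measurable_compose_countable[OF _ f], rule measurable_compose_countable[OF _ g]) simp

lemma measurable_sum_nat:
  fixes f :: "'i \<Rightarrow> 'a \<Rightarrow> nat"
  assumes "\<And>i. i \<in> S \<Longrightarrow> f i \<in> measurable M (count_space UNIV)"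
  shows "(\<lambda>x. \<Sum>i\<in>S. f i x) \<in> measurable M (count_space UNIV)"
  using assms by (induction S rule: infinite_finite_induct) (auto intro: measurable_countable_op2)

lemma prod_emb_count_space:
  "prod_emb I (\<lambda>_. count_space UNIV) J (Pi\<^sub>E J E) = {y\<in>extensional I. \<forall>x\<in>J. y x \<in> E x}"
  unfolding prod_emb_def vimage_def restrict_PiE_iff by (auto simp: PiE_def)

text \<open>Cancelling k against k! shifts the exponential series by one index, and the term at 0
  vanishes. The terms are nonnegative, so the series is also the extended integral, which yields
  integrability.\<close>

lemma poisson_pmf_mean:
  assumes "0 < r"
  shows "integrable (measure_pmf (poisson_pmf r)) real"
    and "(\<integral>k. real k \<partial>measure_pmf (poisson_pmf r)) = r"
proof -
  have "(\<lambda>k. r ^ k / fact k) sums exp r"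
    using exp_converges[of r] by (simp add: divide_inverse mult.commute)
  then have "(\<lambda>k. (r ^ k / fact k) * (r * exp (-r))) sums (exp r * (r * exp (-r)))"
    by (rule sums_mult2)
  also have "exp r * (r * exp (-r)) = r" by (simp add: exp_minus)
  also have "(\<lambda>k. (r ^ k / fact k) * (r * exp (-r))) = (\<lambda>k. r ^ Suc k / fact (Suc k) * exp (-r) * real (Suc k))"
    by (rule ext) (simp add: field_simps del: of_nat_Suc)
  finally have "(\<lambda>k. r ^ k / fact k * exp (-r) * real k) sums r"
    by (subst (asm) sums_Suc_iff) simp
  moreover have "\<And>k. 0 \<le> r ^ k / fact k * exp (-r) * real k" using assms by simp
  ultimately have *: "(\<Sum>k. ennreal (r ^ k / fact k * exp (-r) * real k)) = ennreal r"
    by (intro suminf_ennreal_eq)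
  have "(\<integral>\<^sup>+k. ennreal (real k) \<partial>measure_pmf (poisson_pmf r)) = ennreal r"
    unfolding nn_integral_measure_pmf nn_integral_count_space_nat
    using * assms by (simp add: ennreal_mult[symmetric])
  then have "has_bochner_integral (measure_pmf (poisson_pmf r)) real r"
    by (intro has_bochner_integral_nn_integral) (use assms in auto)
  then show "integrable (measure_pmf (poisson_pmf r)) real"
    "(\<integral>k. real k \<partial>measure_pmf (poisson_pmf r)) = r"
    by (auto simp: has_bochner_integral_iff)
qed

lemma card_increment:
  assumes "\<And>T. finite (A \<inter> {..T::real})" "s \<le> t"
  shows "card (A \<inter> {..t}) = card (A \<inter> {..s}) + card (A \<inter> {s<..t})"
proof -
  have "A \<inter> {..t} = (A \<inter> {..s}) \<union> (A \<inter> {s<..t})" using assms(2) by auto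
  moreover have "finite (A \<inter> {s<..t})" by (rule finite_subset[OF _ assms(1)[of t]]) auto
  ultimately show ?thesis using assms(1)[of s] by (simp add: card_Un_disjoint disjoint_iff)
qed

context prob_space
begin

lemma poisson_process_finite:
  assumes "poisson_process M r A" "\<omega> \<in> space M"
  shows "A \<omega> \<subseteq> {0<..}" "finite (A \<omega> \<inter> {..T})"
  using assms by (auto simp: poisson_process_def)

lemma poisson_increments_indep:
  assumes "poisson_process M r A" "0 \<le> \<tau> 0" "mono \<tau>"
  shows "indep_vars (\<lambda>_. count_space UNIV) (\<lambda>(i::nat) \<omega>. card (A \<omega> \<inter> {\<tau> i<..\<tau> (Suc i)})) UNIV"
  using assms unfolding poisson_process_def by blast

text \<open>Measurability is taken from \<open>indep_vars\<close> for the grid s, t, t, ...; the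
  increment sought is the one with index 0.\<close>

lemma poisson_increment_measurable:
  assumes "poisson_process M r A" "0 \<le> s" "s \<le> t"
  shows "(\<lambda>\<omega>. card (A \<omega> \<inter> {s<..t})) \<in> measurable M (count_space UNIV)"
proof -
  let ?\<tau> = "\<lambda>i::nat. if i = 0 then s else t"
  have "mono ?\<tau>" using assms(3) by (auto simp: mono_def)
  then have "indep_vars (\<lambda>_. count_space UNIV) (\<lambda>i \<omega>. card (A \<omega> \<inter> {?\<tau> i<..?\<tau> (Suc i)})) UNIV"
    using assms(2) by (intro poisson_increments_indep[OF assms(1)]) auto
  then have "\<forall>i. (\<lambda>\<omega>. card (A \<omega> \<inter> {?\<tau> i<..?\<tau> (Suc i)})) \<in> measurable M (count_space UNIV)"
    unfolding indep_vars_def by simp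
  from this[rule_format, of 0] show ?thesis by simp
qed

lemma poisson_count_measurable:
  assumes "poisson_process M r A" "0 \<le> t"
  shows "(\<lambda>\<omega>. card (A \<omega> \<inter> {..t})) \<in> measurable M (count_space UNIV)"
proof -
  have "A \<omega> \<inter> {..t} = A \<omega> \<inter> {0<..t}" if "\<omega> \<in> space M" for \<omega>
    using poisson_process_finite(1)[OF assms(1) that] by auto
  then show ?thesis
    using poisson_increment_measurable[OF assms(1), of 0 t] assms(2)
    by (subst measurable_cong[where g="\<lambda>\<omega>. card (A \<omega> \<inter> {0<..t})"]) auto
qed

lemma poisson_increment_expectation:
  assumes "poisson_process M r A" "0 \<le> s" "s < t" "0 < r"
  shows "integrable M (\<lambda>\<omega>. real (card (A \<omega> \<inter> {s<..t})))"
    and "expectation (\<lambda>\<omega>. real (card (A \<omega> \<inter> {s<..t}))) = r * (t - s)"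
proof -
  let ?K = "\<lambda>\<omega>. card (A \<omega> \<inter> {s<..t})"
  have K: "?K \<in> measurable M (count_space UNIV)"
    using assms by (intro poisson_increment_measurable) auto
  have distr: "distr M (count_space UNIV) ?K = measure_pmf (poisson_pmf (r * (t - s)))"
    using assms by (auto simp: poisson_process_def)
  have pos: "0 < r * (t - s)" using assms by simp
  show "integrable M (\<lambda>\<omega>. real (?K \<omega>))"
    using poisson_pmf_mean(1)[OF pos] unfolding distr[symmetric]
    by (subst (asm) integrable_distr_eq[OF K]) auto
  show "expectation (\<lambda>\<omega>. real (?K \<omega>)) = r * (t - s)"
    using poisson_pmf_mean(2)[OF pos] unfolding distr[symmetric]
    by (subst (asm) integral_distr[OF K]) auto
qed

text \<open>The observation times are sorted together with 0 and \<open>t\<close>. Increments over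
  an ordered grid are independent, and the counts up to \<open>t\<close> are partial sums of those
  that precede the last one.\<close>

lemma poisson_increment_indep_past:
  assumes A: "poisson_process M r A" and t: "0 \<le> t" "t < t'" and S: "finite S" "S \<subseteq> {0..t}"
  shows "\<P>(\<omega> in M. (\<forall>s\<in>S. card (A \<omega> \<inter> {..s}) \<in> E s) \<and> card (A \<omega> \<inter> {t<..t'}) \<in> D) =
    \<P>(\<omega> in M. \<forall>s\<in>S. card (A \<omega> \<inter> {..s}) \<in> E s) * \<P>(\<omega> in M. card (A \<omega> \<inter> {t<..t'}) \<in> D)"
proof -
  let ?C = "count_space UNIV :: nat measure"
  define l where "l = sorted_list_of_set (insert 0 (insert t S))"
  \<comment> \<open>After the sorted times, which end in \<open>t\<close>, the grid stays at
    \<open>t'\<close>. Increment number \<open>m\<close> is therefore the one from \<open>t\<close>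
    to \<open>t'\<close>, and all later ones are empty.\<close>
  define \<tau> where "\<tau> i = (if i < length l then l ! i else t')" for i
  define m where "m = length l - 1"
  define Y where "Y i \<omega> = card (A \<omega> \<inter> {\<tau> i<..\<tau> (Suc i)})" for i \<omega>
  have set_l: "set l = insert 0 (insert t S)" and l_sorted: "sorted l"
    unfolding l_def using S(1) by (simp_all only: sorted_sorted_list_of_set set_sorted_list_of_set finite_insert)
  have l_ne: "l \<noteq> []" using set_l by auto
  have l_bounds: "0 \<le> l ! i" "l ! i \<le> t" if "i < length l" for i
    using nth_mem[OF that] S(2) t unfolding set_l by auto
  have l0: "l ! 0 = 0"
  proof -
    obtain i where "i < length l" "l ! i = 0" using set_l by (metis in_set_conv_nth insertI1)
    then have "l ! 0 \<le> 0" using sorted_nth_mono[OF l_sorted, of 0 i] by auto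
    then show ?thesis using l_bounds(1)[of 0] l_ne by simp
  qed
  have lm: "l ! m = t"
  proof -
    obtain i where "i < length l" "l ! i = t" using set_l by (metis in_set_conv_nth insertI1 insertI2)
    then have "t \<le> l ! m" using sorted_nth_mono[OF l_sorted, of i m] by (auto simp: m_def)
    then show ?thesis using l_bounds(2)[of m] l_ne by (simp add: m_def)
  qed
  have m: "m < length l" "Suc m = length l" using l_ne by (auto simp: m_def)
  have \<tau>0: "\<tau> 0 = 0" using l0 l_ne by (simp add: \<tau>_def)
  have Ym: "Y m \<omega> = card (A \<omega> \<inter> {t<..t'})" for \<omega>
    using lm m by (simp add: Y_def \<tau>_def)
  have mono: "mono \<tau>"
  proof (rule monoI)
    fix i j :: nat assume "i \<le> j"
    then show "\<tau> i \<le> \<tau> j"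
      using sorted_nth_mono[OF l_sorted, of i j] l_bounds(2)[of i] t by (auto simp: \<tau>_def)
  qed
  have ind: "indep_vars (\<lambda>_. ?C) Y UNIV"
    unfolding Y_def using \<tau>0 by (intro poisson_increments_indep[OF A _ mono]) simp
  have count: "card (A \<omega> \<inter> {..\<tau> j}) = (\<Sum>i<j. Y i \<omega>)" if "\<omega> \<in> space M" for \<omega> j
  proof (induction j)
    case 0
    have "A \<omega> \<inter> {..\<tau> 0} = {}" using poisson_process_finite(1)[OF A that] \<tau>0 by auto
    then show ?case by simp
  next
    case (Suc j)
    then show ?case
      using card_increment[OF poisson_process_finite(2)[OF A that], of "\<tau> j" "\<tau> (Suc j)"] monoD[OF mono, of j "Suc j"]
      by (simp add: Y_def)
  qed
  \<comment> \<open>\<open>g\<close> expresses the past event through increments 0 to m-1, an index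
    set disjoint from \<open>{m}\<close>, so that independence of the two blocks applies.\<close>
  define g where "g y \<longleftrightarrow> (\<forall>j\<in>{..m}. l ! j \<in> S \<longrightarrow> (\<Sum>i<j. y i) \<in> E (l ! j))" for y
  have g: "g \<in> measurable (PiM {..<m} (\<lambda>_. ?C)) (count_space UNIV)"
    unfolding g_def
  proof (rule pred_intros_finite, simp)
    fix j assume "j \<in> {..m}"
    then have "(\<lambda>y. \<Sum>i<j. y i) \<in> measurable (PiM {..<m} (\<lambda>_. ?C)) ?C"
      by (intro measurable_sum_nat measurable_component_singleton) auto
    from measurable_compose[OF this, of "\<lambda>x. l ! j \<in> S \<longrightarrow> x \<in> E (l ! j)" "count_space UNIV"]
    show "Measurable.pred (PiM {..<m} (\<lambda>_. ?C)) (\<lambda>y. l ! j \<in> S \<longrightarrow> (\<Sum>i<j. y i) \<in> E (l ! j))"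
      by simp
  qed
  have h: "(\<lambda>y. y m \<in> D) \<in> measurable (PiM {m} (\<lambda>_. ?C)) (count_space UNIV)"
    by (rule measurable_compose[OF measurable_component_singleton, where g="\<lambda>k. k \<in> D"]) auto
  have "indep_var (PiM {..<m} (\<lambda>_. ?C)) (\<lambda>\<omega>. restrict (\<lambda>i. Y i \<omega>) {..<m})
      (PiM {m} (\<lambda>_. ?C)) (\<lambda>\<omega>. restrict (\<lambda>i. Y i \<omega>) {m})"
    by (rule indep_var_restrict[OF ind]) auto
  from prob_indep_random_variable[OF indep_var_compose[OF this g h], of "{True}" "{True}"]
  have eq: "\<P>(\<omega> in M. g (restrict (\<lambda>i. Y i \<omega>) {..<m}) \<and> Y m \<omega> \<in> D) =
      \<P>(\<omega> in M. g (restrict (\<lambda>i. Y i \<omega>) {..<m})) * \<P>(\<omega> in M. Y m \<omega> \<in> D)"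
    by simp
  have past: "g (restrict (\<lambda>i. Y i \<omega>) {..<m}) \<longleftrightarrow> (\<forall>s\<in>S. card (A \<omega> \<inter> {..s}) \<in> E s)"
    if "\<omega> \<in> space M" for \<omega>
  proof -
    have "(\<Sum>i<j. restrict (\<lambda>i. Y i \<omega>) {..<m} i) = card (A \<omega> \<inter> {..l ! j})" if "j \<le> m" for j
    proof -
      have "(\<Sum>i<j. restrict (\<lambda>i. Y i \<omega>) {..<m} i) = (\<Sum>i<j. Y i \<omega>)"
        by (rule sum.cong) (use that in auto)
      then show ?thesis using count[OF \<open>\<omega> \<in> space M\<close>, of j] that m by (simp add: \<tau>_def)
    qed
    then have "g (restrict (\<lambda>i. Y i \<omega>) {..<m}) \<longleftrightarrow>
        (\<forall>j\<in>{..m}. l ! j \<in> S \<longrightarrow> card (A \<omega> \<inter> {..l ! j}) \<in> E (l ! j))"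
      by (simp add: g_def)
    also have "\<dots> \<longleftrightarrow> (\<forall>s\<in>set l. s \<in> S \<longrightarrow> card (A \<omega> \<inter> {..s}) \<in> E s)"
      unfolding all_set_conv_all_nth m(2)[symmetric] by (auto simp: less_Suc_eq_le)
    also have "\<dots> \<longleftrightarrow> (\<forall>s\<in>S. card (A \<omega> \<inter> {..s}) \<in> E s)" unfolding set_l by auto
    finally show ?thesis .
  qed
  show ?thesis
    using eq unfolding Ym by (simp add: past cong: conj_cong)
qed

text \<open>Cylinder events generate the history and are closed under intersection, so it suffices
  to factor probabilities on them. Such an event is an intersection over the items. The increment
  touches only the factor of item \<open>n\<close>, where
  \<open>poisson_increment_indep_past\<close> applies; independence across items takes care of the
  rest.\<close>

lemma request_history_indep_increment:
  assumes req: "request_processes M N \<beta> p A" and n: "n \<in> {1..N}" and t: "0 \<le> t" "t < t'"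
    and X: "X \<in> borel_measurable (request_history M N A t)"
  shows "indep_var borel X borel (\<lambda>\<omega>. real (card (A n \<omega> \<inter> {t<..t'})))"
proof -
  let ?C = "count_space UNIV :: nat measure"
  let ?P = "PiM {0::real..} (\<lambda>_. ?C)" and ?I = "{1..N} \<times> {0..t}"
  let ?f = "\<lambda>\<omega>. \<lambda>(n, s)\<in>?I. card (A n \<omega> \<inter> {..s})"
  let ?K = "\<lambda>\<omega>. card (A n \<omega> \<inter> {t<..t'})"
  let ?Z = "\<lambda>n \<omega>. \<lambda>t\<in>{0::real..}. card (A n \<omega> \<inter> {..t})"
  define G where "G = {?f -` B \<inter> space M | B. B \<in> prod_algebra ?I (\<lambda>_. ?C)}"
  define H where "H = {?K -` D \<inter> space M | D. D \<in> sets ?C}"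
  have pp: "poisson_process M (\<beta> * p k) (A k)" if "k \<in> {1..N}" for k
    using req that by (simp add: request_processes_def)
  have ind: "indep_vars (\<lambda>_. ?P) ?Z {1..N}" using req by (simp add: request_processes_def)
  have K: "?K \<in> measurable M ?C" using pp[OF n] t by (intro poisson_increment_measurable) auto
  have f: "?f \<in> measurable M (PiM ?I (\<lambda>_. ?C))"
  proof (rule measurable_restrict)
    fix x assume "x \<in> ?I"
    then show "(\<lambda>\<omega>. case x of (k, s) \<Rightarrow> card (A k \<omega> \<inter> {..s})) \<in> measurable M ?C"
      using poisson_count_measurable[OF pp] by (cases x) simp
  qed
  have hist: "sets (request_history M N A t) = sigma_sets (space M) G"
  proof -
    have f_in: "?f \<in> space M \<rightarrow> (\<Pi>\<^sub>E i\<in>?I. space ?C)" by (simp add: Pi_iff)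
    show ?thesis
      unfolding request_history_def G_def sigma_sets_vimage_commute[OF f_in, symmetric] sets_PiM[symmetric]
      using f_in by (intro sets_vimage_algebra2) (simp add: space_PiM)
  qed
  have hist_events: "sets (request_history M N A t) \<subseteq> events"
    unfolding request_history_def by (rule sets_image_in_sets[OF refl f])
  have "indep_set G H"
  proof (rule indep_setI)
    show "G \<subseteq> events" using hist_events unfolding hist by (blast intro: sigma_sets.Basic)
    show "H \<subseteq> events" unfolding H_def using measurable_sets[OF K] by blast
    fix a b assume "a \<in> G" "b \<in> H"
    then obtain B D where B: "B \<in> prod_algebra ?I (\<lambda>_. ?C)" "a = ?f -` B \<inter> space M"
      and b: "b = ?K -` D \<inter> space M" unfolding G_def H_def by blast
    from B(1) obtain J E where J: "B = prod_emb ?I (\<lambda>_. ?C) J (Pi\<^sub>E J E)" "finite J" "J \<subseteq> ?I"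
      by (rule prod_algebraE)
    define S where "S k = {s. (k, s) \<in> J}" for k
    have S: "finite (S k)" "S k \<subseteq> {0..t}" for k
    proof -
      have "S k \<subseteq> snd ` J" by (force simp: S_def)
      then show "finite (S k)" using J(2) finite_surj by blast
      show "S k \<subseteq> {0..t}" using J(3) by (auto simp: S_def)
    qed
    \<comment> \<open>The events are rewritten as sets of whole counting paths, the objects whose
      independence across items is assumed. \<open>both\<close> adds the condition on the increment
      in coordinate \<open>n\<close> only.\<close>
    define past where "past k = {y\<in>space ?P. \<forall>s\<in>S k. y s \<in> E (k, s)}" for k
    define both where "both k = (if k = n then {y\<in>space ?P. (\<forall>s\<in>S k. y s \<in> E (k, s)) \<and> y t' - y t \<in> D} else past k)" for k
    have comp: "(\<lambda>y. y s) \<in> measurable ?P ?C" if "0 \<le> s" for s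
      using that by (intro measurable_component_singleton) auto
    have pred_past: "Measurable.pred ?P (\<lambda>y. \<forall>s\<in>S k. y s \<in> E (k, s))" for k
    proof (rule pred_intros_finite[OF S(1)])
      fix s assume "s \<in> S k"
      then show "Measurable.pred ?P (\<lambda>y. y s \<in> E (k, s))"
        using S(2)[of k] by (intro measurable_compose[OF comp, where g="\<lambda>z. z \<in> E (k, s)"]) auto
    qed
    have pred_inc: "Measurable.pred ?P (\<lambda>y. y t' - y t \<in> D)"
      by (rule measurable_compose[OF measurable_countable_op2[OF comp comp], where g="\<lambda>z. z \<in> D"]) (use t in auto)
    have past: "past k \<in> sets ?P" for k
      unfolding past_def using pred_past[of k] by (simp add: pred_def)
    have both: "both k \<in> sets ?P" for k
      using past[of k] pred_past[of n] pred_inc by (auto simp: both_def pred_def sets.sets_Collect_conj)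
    have Z_past: "?Z k -` past k \<inter> space M = {\<omega>\<in>space M. \<forall>s\<in>S k. card (A k \<omega> \<inter> {..s}) \<in> E (k, s)}" for k
      using S(2)[of k] by (auto simp: past_def space_PiM subset_iff)
    \<comment> \<open>Subtraction of naturals is truncated; here it is exact since the counts
      increase in time.\<close>
    have inc: "card (A n \<omega> \<inter> {..t'}) - card (A n \<omega> \<inter> {..t}) = ?K \<omega>" if "\<omega> \<in> space M" for \<omega>
      using card_increment[OF poisson_process_finite(2)[OF pp[OF n] that], of t t'] t by simp
    have Z_both: "?Z n -` both n \<inter> space M =
        {\<omega>\<in>space M. (\<forall>s\<in>S n. card (A n \<omega> \<inter> {..s}) \<in> E (n, s)) \<and> ?K \<omega> \<in> D}"
      using S(2)[of n] t inc by (auto simp: both_def space_PiM subset_iff)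
    have a: "a = (\<Inter>k\<in>{1..N}. ?Z k -` past k \<inter> space M)"
    proof -
      have "a = {\<omega>\<in>space M. \<forall>(k, s)\<in>J. card (A k \<omega> \<inter> {..s}) \<in> E (k, s)}"
      proof -
        have "\<omega> \<in> a \<longleftrightarrow> \<omega> \<in> space M \<and> (\<forall>x\<in>J. ?f \<omega> x \<in> E x)" for \<omega>
          unfolding B(2) J(1) prod_emb_count_space by (auto simp del: restrict_apply)
        moreover have "?f \<omega> x = (case x of (k, s) \<Rightarrow> card (A k \<omega> \<inter> {..s}))" if "x \<in> J" for \<omega> x
          using J(3) that by (auto simp: restrict_def)
        ultimately show ?thesis by (auto simp: split_beta)
      qed
      also have "\<dots> = (\<Inter>k\<in>{1..N}. ?Z k -` past k \<inter> space M)"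
        unfolding Z_past using J(3) n by (auto simp: S_def)
      finally show ?thesis .
    qed
    have INT_remove: "(\<Inter>k\<in>{1..N}. C k) = C n \<inter> (\<Inter>k\<in>{1..N} - {n}. C k)" for C :: "nat \<Rightarrow> 'a set"
      using n by blast
    have ab: "a \<inter> b = (\<Inter>k\<in>{1..N}. ?Z k -` both k \<inter> space M)"
    proof -
      have "(\<Inter>k\<in>{1..N}. ?Z k -` both k \<inter> space M) =
          (?Z n -` both n \<inter> space M) \<inter> (\<Inter>k\<in>{1..N} - {n}. ?Z k -` both k \<inter> space M)"
        by (rule INT_remove)
      also have "(\<Inter>k\<in>{1..N} - {n}. ?Z k -` both k \<inter> space M) = (\<Inter>k\<in>{1..N} - {n}. ?Z k -` past k \<inter> space M)"
        by (rule INF_cong) (simp_all add: both_def)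
      also have "?Z n -` both n \<inter> space M = (?Z n -` past n \<inter> space M) \<inter> b"
        unfolding Z_both Z_past b by blast
      also have "\<dots> \<inter> (\<Inter>k\<in>{1..N} - {n}. ?Z k -` past k \<inter> space M) = a \<inter> b"
      proof -
        have "a = (?Z n -` past n \<inter> space M) \<inter> (\<Inter>k\<in>{1..N} - {n}. ?Z k -` past k \<inter> space M)"
          unfolding a by (rule INT_remove)
        then show ?thesis by (simp only: Int_assoc Int_commute Int_left_commute)
      qed
      finally show ?thesis by (rule sym)
    qed
    have ne: "{1..N} \<noteq> {}" using n by auto
    let ?R = "\<Prod>k\<in>{1..N} - {n}. prob (?Z k -` past k \<inter> space M)"
    have "prob (a \<inter> b) = (\<Prod>k\<in>{1..N}. prob (?Z k -` both k \<inter> space M))"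
      unfolding ab by (rule indep_varsD_finite[OF ind ne]) (use both in auto)
    also have "\<dots> = prob (?Z n -` both n \<inter> space M) * ?R"
      using n by (subst prod.remove[of _ n]) (auto simp: both_def)
    also have "prob (?Z n -` both n \<inter> space M) = prob (?Z n -` past n \<inter> space M) * prob b"
      using poisson_increment_indep_past[OF pp[OF n] t S, where E="\<lambda>s. E (n, s)" and D=D]
      unfolding Z_both Z_past b by (simp add: vimage_def Int_def conj_commute)
    also have "prob (?Z n -` past n \<inter> space M) * prob b * ?R =
        (\<Prod>k\<in>{1..N}. prob (?Z k -` past k \<inter> space M)) * prob b"
      using n by (subst (2) prod.remove[of _ n]) auto
    also have "(\<Prod>k\<in>{1..N}. prob (?Z k -` past k \<inter> space M)) = prob a"
      unfolding a by (rule indep_varsD_finite[OF ind ne, symmetric]) (use past in auto)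
    finally show "prob (a \<inter> b) = prob a * prob b" .
  qed
  moreover have "Int_stable G"
  proof (rule Int_stableI)
    fix a b assume "a \<in> G" "b \<in> G"
    then obtain B B' where B: "B \<in> prod_algebra ?I (\<lambda>_. ?C)" "B' \<in> prod_algebra ?I (\<lambda>_. ?C)"
      "a = ?f -` B \<inter> space M" "b = ?f -` B' \<inter> space M" unfolding G_def by auto
    have "a \<inter> b = ?f -` (B \<inter> B') \<inter> space M" unfolding B(3,4) by auto
    moreover have "B \<inter> B' \<in> prod_algebra ?I (\<lambda>_. ?C)"
      using Int_stable_prod_algebra B(1,2) by (auto simp: Int_stable_def)
    ultimately show "a \<inter> b \<in> G" unfolding G_def by blast
  qed
  moreover have "Int_stable H"
  proof (rule Int_stableI)
    fix a b assume "a \<in> H" "b \<in> H"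
    then obtain D D' where "a = ?K -` D \<inter> space M" "b = ?K -` D' \<inter> space M" unfolding H_def by blast
    then have "a \<inter> b = ?K -` (D \<inter> D') \<inter> space M" by blast
    then show "a \<inter> b \<in> H" unfolding H_def sets_count_space by blast
  qed
  ultimately have indep: "indep_set (sets (request_history M N A t)) (sigma_sets (space M) H)"
    unfolding hist by (rule indep_set_sigma_sets)
  have space_hist: "space (request_history M N A t) = space M" by (simp add: request_history_def)
  have X': "X \<in> borel_measurable M"
    by (rule measurable_mono[of borel borel, THEN subsetD, OF _ _ _ _ X]) (use hist_events space_hist in auto)
  \<comment> \<open>The \<sigma>-algebras generated by \<open>X\<close> and by the real-valued
    increment lie inside the two independent ones and inherit their independence.\<close>
  have sub1: "sigma_sets (space M) {X -` B \<inter> space M | B. B \<in> sets borel} \<subseteq> sets (request_history M N A t)"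
    using sets.sigma_sets_subset[of "{X -` B \<inter> space M | B. B \<in> sets borel}" "request_history M N A t"]
      measurable_sets[OF X] unfolding space_hist by auto
  have sub2: "sigma_sets (space M) {(\<lambda>\<omega>. real (?K \<omega>)) -` B \<inter> space M | B. B \<in> sets borel} \<subseteq> sigma_sets (space M) H"
  proof (rule sigma_sets_mono)
    show "{(\<lambda>\<omega>. real (?K \<omega>)) -` B \<inter> space M | B. B \<in> sets borel} \<subseteq> sigma_sets (space M) H"
    proof safe
      fix B :: "real set"
      have "(\<lambda>\<omega>. real (?K \<omega>)) -` B \<inter> space M = ?K -` (real -` B) \<inter> space M" by blast
      then show "(\<lambda>\<omega>. real (?K \<omega>)) -` B \<inter> space M \<in> sigma_sets (space M) H"
        unfolding H_def sets_count_space by (intro sigma_sets.Basic) blast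
    qed
  qed
  show ?thesis
    unfolding indep_var_eq indep_sets2_eq
  proof (intro conjI ballI)
    show "X \<in> borel_measurable M" by (rule X')
    show K': "(\<lambda>\<omega>. real (?K \<omega>)) \<in> borel_measurable M" using measurable_compose[OF K, of real borel] by simp
    show "sigma_sets (space M) {X -` B \<inter> space M | B. B \<in> sets borel} \<subseteq> events"
      using sub1 hist_events by (rule subset_trans)
    show "sigma_sets (space M) {(\<lambda>\<omega>. real (?K \<omega>)) -` B \<inter> space M | B. B \<in> sets borel} \<subseteq> events"
      using sub2 indep_setD_ev2[OF indep] by (rule subset_trans)
    show "prob (a \<inter> b) = prob a * prob b"
      if "a \<in> sigma_sets (space M) {X -` B \<inter> space M | B. B \<in> sets borel}"
        "b \<in> sigma_sets (space M) {(\<lambda>\<omega>. real (?K \<omega>)) -` B \<inter> space M | B. B \<in> sets borel}" for a b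
      using that sub1 sub2 by (intro indep_setD[OF indep]) blast+
  qed
qed

end

section \<open>The compensated request sum has mean zero\<close>

text \<open>Cells are open on the left, so the value at a point x of a cell is that of
  \<open>c\<close> strictly before x. This matches the dependence of the age on the strict
  past.\<close>

definition left_step :: "real \<Rightarrow> nat \<Rightarrow> (real \<Rightarrow> real) \<Rightarrow> real \<Rightarrow> real" where
  "left_step T m c x = (\<Sum>i<m. c (T * real i / real m) * indicator {T * real i / real m<..T * real (Suc i) / real m} x)"

text \<open>\<open>y\<close> is the left end of the cell containing \<open>x\<close>. It depends on
  the grid alone, so one \<open>y\<close> serves all functions \<open>c\<close>.\<close>

lemma left_step_eq:
  assumes "0 < x" "x \<le> T" "0 < m"
  obtains y where "\<And>c. left_step T m c x = c y" "0 \<le> y" "y < x" "x - y \<le> T / real m"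
proof -
  define z where "z = x * m / T"
  \<comment> \<open>Cells are closed on the right, so the cell index is the ceiling minus one and
    not the floor.\<close>
  define i where "i = nat (\<lceil>z\<rceil> - 1)"
  have T: "0 < T" using assms by simp
  have z: "0 < z" "z \<le> m" using assms T by (auto simp: z_def field_simps)
  then have i: "real i < z" "z \<le> real i + 1"
    unfolding i_def by linarith+
  have im: "i < m" using i(1) z(2) by linarith
  have less: "T * real j / m < x \<longleftrightarrow> real j < z" for j
    using T assms(3) by (auto simp: z_def field_simps)
  have le: "x \<le> T * real j / m \<longleftrightarrow> z \<le> real j" for j
    using T assms(3) by (auto simp: z_def field_simps)
  have ind: "indicator {T * real j / m<..T * real (Suc j) / m} x = (if i = j then 1 else 0 :: real)" for j
  proof -
    have "x \<in> {T * real j / m<..T * real (Suc j) / m} \<longleftrightarrow> i = j"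
      unfolding greaterThanAtMost_iff less le using i by auto
    then show ?thesis by (simp add: indicator_def)
  qed
  show ?thesis
  proof (rule that)
    show "left_step T m c x = c (T * real i / m)" for c
      using im unfolding left_step_def ind by (simp add: if_distrib cong: if_cong)
    show "0 \<le> T * real i / m" using T by simp
    show "T * real i / m < x" unfolding less by (rule i(1))
    have "x \<le> T * real (Suc i) / m" unfolding le using i(2) by simp
    then show "x - T * real i / m \<le> T / real m"
      by (simp add: distrib_left add_divide_distrib)
  qed
qed

lemma left_step_0:
  assumes "0 \<le> T"
  shows "left_step T m c 0 = 0"
  unfolding left_step_def using assms by (intro sum.neutral) (auto simp: indicator_def not_less)

text \<open>The left cell ends approach \<open>x\<close> strictly from below, so left-continuity of
  the age applies. At 0, which lies in no cell, both sides vanish.\<close>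

lemma left_step_min_age_tendsto:
  assumes F: "locally_finite F" and "0 \<le> \<tau>" "0 \<le> x" "x \<le> T"
  shows "(\<lambda>m. left_step T (Suc m) (\<lambda>t. min (age F t) \<tau>) x) \<longlonglongrightarrow> min (age F x) \<tau>"
proof (cases "x = 0")
  case True
  then show ?thesis using assms by (simp add: left_step_0 age_0)
next
  case False
  then have x: "0 < x" using assms by simp
  have "\<exists>y. (\<forall>c. left_step T (Suc m) c x = c y) \<and> 0 \<le> y \<and> y < x \<and> x - y \<le> T / real (Suc m)" for m
    using left_step_eq[OF x assms(4), of "Suc m"] by (metis zero_less_Suc)
  then obtain y where y: "\<And>m c. left_step T (Suc m) c x = c (y m)" "\<And>m. 0 \<le> y m" "\<And>m. y m < x"
      "\<And>m. x - y m \<le> T / real (Suc m)" by metis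
  have "(\<lambda>m. T / real (Suc m)) \<longlonglongrightarrow> 0"
    using LIMSEQ_Suc[OF lim_const_over_n[of T]] by simp
  then have "(\<lambda>m. x - y m) \<longlonglongrightarrow> 0"
    by (rule real_tendsto_sandwich[rotated 3, OF _ _ _ tendsto_const])
       (use y(3,4) in \<open>auto intro!: always_eventually simp: less_imp_le\<close>)
  then have "(\<lambda>m. x - (x - y m)) \<longlonglongrightarrow> x - 0" by (intro tendsto_intros)
  then have "(\<lambda>m. age F (y m)) \<longlonglongrightarrow> age F x"
    using y(2,3) by (intro age_left_lim[OF F x]) auto
  then show ?thesis unfolding y(1) by (intro tendsto_intros)
qed

lemma sum_left_step:
  assumes "finite (A \<inter> {..T})" "0 \<le> T"
  shows "(\<Sum>x\<in>A \<inter> {..T}. left_step T m c x) =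
    (\<Sum>i<m. c (T * real i / real m) * real (card (A \<inter> {T * real i / real m<..T * real (Suc i) / real m})))"
proof -
  have "(\<Sum>x\<in>A \<inter> {..T}. left_step T m c x) =
      (\<Sum>i<m. c (T * real i / real m) * (\<Sum>x\<in>A \<inter> {..T}. indicator {T * real i / real m<..T * real (Suc i) / real m} x))"
    unfolding left_step_def by (subst sum.swap) (simp add: sum_distrib_left)
  also have "\<dots> = (\<Sum>i<m. c (T * real i / real m) * real (card (A \<inter> {T * real i / real m<..T * real (Suc i) / real m})))"
  proof (rule sum.cong[OF refl])
    fix i assume "i \<in> {..<m}"
    then have "T * real (Suc i) / m \<le> T * 1"
      unfolding times_divide_eq_right[symmetric] using assms(2) by (intro mult_left_mono) auto
    then have "A \<inter> {..T} \<inter> {T * real i / real m<..T * real (Suc i) / real m} = A \<inter> {T * real i / real m<..T * real (Suc i) / real m}"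
      by auto
    then show "c (T * real i / real m) * (\<Sum>x\<in>A \<inter> {..T}. indicator {T * real i / real m<..T * real (Suc i) / real m} x) =
        c (T * real i / real m) * real (card (A \<inter> {T * real i / real m<..T * real (Suc i) / real m}))"
      using assms(1) by (simp add: indicator_def sum.If_cases Int_def)
  qed
  finally show ?thesis .
qed

lemma has_integral_left_step:
  assumes "0 \<le> T"
  shows "(left_step T m c has_integral (\<Sum>i<m. c (T * real i / real m) * (T / real m))) {0..T}"
  unfolding left_step_def
proof (intro has_integral_sum finite_lessThan)
  fix i assume i: "i \<in> {..<m}"
  let ?a = "T * real i / m" and ?b = "T * real (Suc i) / m"
  have "?b \<le> T * 1"
    unfolding times_divide_eq_right[symmetric] using assms i by (intro mult_left_mono) auto
  moreover have ab: "0 \<le> ?a" "?a \<le> ?b"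
    using assms by (auto intro!: divide_right_mono mult_left_mono)
  ultimately have sub: "{?a..?b} \<subseteq> {0..T}" by auto
  have "((\<lambda>x. c ?a) has_integral (?b - ?a) * c ?a) {?a..?b}"
    using has_integral_const_real[of "c ?a" ?a ?b] ab(2) by simp
  then have "((\<lambda>x. if x \<in> {?a..?b} then c ?a else 0) has_integral (?b - ?a) * c ?a) {0..T}"
    by (subst has_integral_restrict[OF sub])
  moreover have "(?b - ?a) * c ?a = c ?a * (T / real m)"
    by (simp add: field_simps diff_divide_distrib[symmetric])
  ultimately have "((\<lambda>x. if x \<in> {?a..?b} then c ?a else 0) has_integral c ?a * (T / real m)) {0..T}" by simp
  then show "((\<lambda>x. c ?a * indicator {?a<..?b} x) has_integral c ?a * (T / real m)) {0..T}"
    by (rule has_integral_spike_finite[of "{?a}", rotated 2]) (auto simp: indicator_def)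
qed

lemma left_step_bound:
  assumes "\<And>t. 0 \<le> t \<Longrightarrow> \<bar>c t\<bar> \<le> C" "0 \<le> C" "0 \<le> x" "x \<le> T" "0 < m"
  shows "\<bar>left_step T m c x\<bar> \<le> C"
proof (cases "x = 0")
  case True then show ?thesis using assms by (simp add: left_step_0)
next
  case False
  then show ?thesis using left_step_eq[of x T m] assms by (metis less_eq_real_def)
qed

context prob_space
begin

text \<open>A left-endpoint value is known at the start of its cell, hence independent of the number
  of requests in the cell, whose mean is the rate times the cell length. Each term of the
  approximating sum is thus centred, and dominated convergence carries mean zero to the pathwise
  limit.\<close>

lemma compensated_requests_expectation:
  assumes req: "request_processes M N \<beta> p A" and n: "n \<in> {1..N}" and b: "0 < \<beta> * p n"
    and F: "\<And>\<omega>. \<omega> \<in> space M \<Longrightarrow> locally_finite (F \<omega>)"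
    and meas: "\<And>t. 0 \<le> t \<Longrightarrow> (\<lambda>\<omega>. age (F \<omega>) t) \<in> borel_measurable (request_history M N A t)"
    and T: "0 < T" and \<tau>: "0 \<le> \<tau>"
  shows "has_bochner_integral M (\<lambda>\<omega>. compensated_requests (\<beta> * p n) \<tau> (A n \<omega>) (F \<omega>) T) 0"
proof -
  let ?b = "\<beta> * p n"
  let ?w = "\<lambda>\<omega> t. min (age (F \<omega>) t) \<tau>"
  let ?t = "\<lambda>m i. T * real i / real (Suc m)"
  let ?K = "\<lambda>m i \<omega>. real (card (A n \<omega> \<inter> {?t m i<..?t m (Suc i)}))"
  let ?D = "\<lambda>m \<omega>. \<Sum>i<Suc m. ?w \<omega> (?t m i) * (?K m i \<omega> - ?b * (T / real (Suc m)))"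
  have pp: "poisson_process M ?b (A n)" using req n by (simp add: request_processes_def)
  have pos: "A n \<omega> \<subseteq> {0<..}" and fin: "finite (A n \<omega> \<inter> {..T})" if "\<omega> \<in> space M" for \<omega>
    using poisson_process_finite[OF pp that] by auto
  have t: "0 \<le> ?t m i" "?t m i < ?t m (Suc i)" for m i
    using T by (auto intro!: divide_strict_right_mono mult_strict_left_mono)
  have t_diff: "?t m (Suc i) - ?t m i = T / real (Suc m)" for m i
    unfolding diff_divide_distrib[symmetric] by (simp add: algebra_simps)
  have w_bound: "\<bar>?w \<omega> t\<bar> \<le> \<tau>" if "\<omega> \<in> space M" "0 \<le> t" for \<omega> t
    using age_nonneg[OF F[OF that(1)] that(2)] \<tau> by auto
  have D_eq: "?D m \<omega> = (\<Sum>x\<in>A n \<omega> \<inter> {..T}. left_step T (Suc m) (?w \<omega>) x) -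
      ?b * integral {0..T} (left_step T (Suc m) (?w \<omega>))" if "\<omega> \<in> space M" for m \<omega>
    using T unfolding sum_left_step[OF fin[OF that] less_imp_le[OF T]]
      integral_unique[OF has_integral_left_step[OF less_imp_le[OF T]]]
    by (simp only: right_diff_distrib sum_subtractf sum_distrib_left mult_ac)
  have lim: "(\<lambda>m. ?D m \<omega>) \<longlonglongrightarrow> compensated_requests ?b \<tau> (A n \<omega>) (F \<omega>) T" if \<omega>: "\<omega> \<in> space M" for \<omega>
    unfolding D_eq[OF \<omega>] compensated_requests_def
  proof (intro tendsto_diff tendsto_mult tendsto_const tendsto_sum)
    fix x assume "x \<in> A n \<omega> \<inter> {..T}"
    then show "(\<lambda>m. left_step T (Suc m) (?w \<omega>) x) \<longlonglongrightarrow> ?w \<omega> x"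
      using pos[OF \<omega>] by (intro left_step_min_age_tendsto[OF F[OF \<omega>] \<tau>]) auto
  next
    show "(\<lambda>m. integral {0..T} (left_step T (Suc m) (?w \<omega>))) \<longlonglongrightarrow> integral {0..T} (?w \<omega>)"
    proof (rule dominated_convergence(2)[where h="\<lambda>_. \<tau>"])
      show "left_step T (Suc m) (?w \<omega>) integrable_on {0..T}" for m
        using has_integral_integrable[OF has_integral_left_step] T by auto
      show "norm (left_step T (Suc m) (?w \<omega>) x) \<le> \<tau>" if "x \<in> {0..T}" for m x
        unfolding real_norm_def using that w_bound[OF \<omega>] \<tau> by (intro left_step_bound) auto
      show "(\<lambda>m. left_step T (Suc m) (?w \<omega>) x) \<longlonglongrightarrow> ?w \<omega> x" if "x \<in> {0..T}" for x
        using that by (intro left_step_min_age_tendsto[OF F[OF \<omega>] \<tau>]) auto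
    qed auto
  qed
  have K_int: "integrable M (?K m i)" "expectation (?K m i) = ?b * (T / real (Suc m))" for m i
    using poisson_increment_expectation[OF pp t(1)[of i m] t(2)[of i m] b] unfolding t_diff by auto
  have w_meas: "(\<lambda>\<omega>. ?w \<omega> t) \<in> borel_measurable (request_history M N A t)" if "0 \<le> t" for t
    using meas[OF that] by measurable
  have ind: "indep_var borel (\<lambda>\<omega>. ?w \<omega> (?t m i)) borel (?K m i)" for m i
    using request_history_indep_increment[OF req n t w_meas[OF t(1)]] .
  have w_int: "integrable M (\<lambda>\<omega>. ?w \<omega> (?t m i))" for m i
  proof (rule integrable_const_bound)
    show "AE \<omega> in M. norm (?w \<omega> (?t m i)) \<le> \<tau>"
      unfolding real_norm_def by (intro AE_I2 w_bound t(1))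
    show "(\<lambda>\<omega>. ?w \<omega> (?t m i)) \<in> borel_measurable M"
      using ind by (rule indep_var_rv1)
  qed
  \<comment> \<open>By independence the mean of the product is the product of the means, which the
    compensator subtracts exactly.\<close>
  have term_int: "integrable M (\<lambda>\<omega>. ?w \<omega> (?t m i) * (?K m i \<omega> - ?b * (T / real (Suc m))))"
    and term_0: "expectation (\<lambda>\<omega>. ?w \<omega> (?t m i) * (?K m i \<omega> - ?b * (T / real (Suc m)))) = 0" for m i
    using indep_var_integrable[OF ind[of i m] w_int[of i m] K_int(1)[of i m]]
      indep_var_lebesgue_integral[OF ind[of i m] w_int[of i m] K_int(1)[of i m]] w_int[of i m] K_int(2)[of i m]
    by (simp_all add: right_diff_distrib)
  have D_int: "integrable M (?D m)" and D_0: "expectation (?D m) = 0" for m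
    using term_int term_0 by (auto simp del: sum.lessThan_Suc)
  \<comment> \<open>The weights are bounded by \<tau>, so \<tau> times the number of requests up to
    \<open>T\<close> plus the total compensator dominates all approximating sums at once.\<close>
  define B where "B \<omega> = \<tau> * (real (card (A n \<omega> \<inter> {0<..T})) + ?b * T)" for \<omega>
  have B_int: "integrable M B"
    unfolding B_def using poisson_increment_expectation(1)[OF pp _ T b] by auto
  have D_bound: "\<bar>?D m \<omega>\<bar> \<le> B \<omega>" if \<omega>: "\<omega> \<in> space M" for m \<omega>
  proof -
    have "\<bar>\<Sum>x\<in>A n \<omega> \<inter> {..T}. left_step T (Suc m) (?w \<omega>) x\<bar> \<le> (\<Sum>x\<in>A n \<omega> \<inter> {..T}. \<tau>)"
      by (rule order_trans[OF sum_abs sum_mono])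
         (use pos[OF \<omega>] w_bound[OF \<omega>] \<tau> in \<open>auto intro!: left_step_bound\<close>)
    also have "\<dots> = \<tau> * card (A n \<omega> \<inter> {0<..T})"
    proof -
      have "A n \<omega> \<inter> {..T} = A n \<omega> \<inter> {0<..T}" using pos[OF \<omega>] by auto
      then show ?thesis by simp
    qed
    finally have 1: "\<bar>\<Sum>x\<in>A n \<omega> \<inter> {..T}. left_step T (Suc m) (?w \<omega>) x\<bar> \<le> \<tau> * card (A n \<omega> \<inter> {0<..T})" .
    have "norm (integral {0..T} (left_step T (Suc m) (?w \<omega>))) \<le> integral {0..T} (\<lambda>_. \<tau>)"
    proof (rule integral_norm_bound_integral)
      show "left_step T (Suc m) (?w \<omega>) integrable_on {0..T}"
        using has_integral_integrable[OF has_integral_left_step] T by auto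
      show "norm (left_step T (Suc m) (?w \<omega>) x) \<le> \<tau>" if "x \<in> {0..T}" for x
        unfolding real_norm_def using that w_bound[OF \<omega>] \<tau> by (intro left_step_bound) auto
    qed auto
    then have "\<bar>integral {0..T} (left_step T (Suc m) (?w \<omega>))\<bar> \<le> T * \<tau>"
      using T by simp
    then have "\<bar>?b * integral {0..T} (left_step T (Suc m) (?w \<omega>))\<bar> \<le> ?b * (T * \<tau>)"
      unfolding abs_mult[of ?b] abs_of_pos[OF b] by (intro mult_left_mono less_imp_le[OF b])
    with 1 show ?thesis unfolding D_eq[OF \<omega>] B_def by (simp add: algebra_simps)
  qed
  let ?L = "\<lambda>\<omega>. compensated_requests ?b \<tau> (A n \<omega>) (F \<omega>) T"
  have L_meas: "?L \<in> borel_measurable M"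
    by (rule borel_measurable_LIMSEQ_real[OF lim]) (use D_int in auto)
  note dc = L_meas borel_measurable_integrable[OF D_int] B_int AE_I2[OF lim]
  have bound: "AE \<omega> in M. norm (?D m \<omega>) \<le> B \<omega>" for m
    unfolding real_norm_def by (intro AE_I2 D_bound)
  have "integrable M ?L" by (rule integrable_dominated_convergence[OF dc bound])
  moreover have "(\<lambda>m. expectation (?D m)) \<longlonglongrightarrow> expectation ?L"
    by (rule integral_dominated_convergence[OF dc bound])
  then have "expectation ?L = 0" unfolding D_0 by (simp add: LIMSEQ_const_iff)
  ultimately show ?thesis by (simp add: has_bochner_integral_iff)
qed

end

section \<open>Adaptedness of the age and of the threshold policy\<close>

lemma space_request_history [simp]: "space (request_history M N A t) = space M"
  by (simp add: request_history_def)

lemma request_history_count: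
  assumes "k \<in> {1..N}" "0 \<le> s" "s \<le> t"
  shows "(\<lambda>\<omega>. card (A k \<omega> \<inter> {..s})) \<in> measurable (request_history M N A t) (count_space UNIV)"
proof -
  let ?I = "{1..N} \<times> {0..t}" and ?C = "count_space UNIV :: nat measure"
  let ?f = "\<lambda>\<omega>. \<lambda>(n, s)\<in>?I. card (A n \<omega> \<inter> {..s})"
  have ks: "(k, s) \<in> ?I" using assms by simp
  have "?f \<in> measurable (request_history M N A t) (PiM ?I (\<lambda>_. ?C))"
    unfolding request_history_def by (rule measurable_vimage_algebra1) (simp add: space_PiM)
  from measurable_compose[OF this measurable_component_singleton[OF ks]]
  show ?thesis using ks by simp
qed

lemma request_history_mono:
  assumes "s \<le> t"
  shows "sets (request_history M N A s) \<subseteq> sets (request_history M N A t)"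
proof -
  let ?I = "{1..N} \<times> {0..s}" and ?C = "count_space UNIV :: nat measure"
  have "(\<lambda>\<omega>. \<lambda>(n, s)\<in>?I. card (A n \<omega> \<inter> {..s})) \<in> measurable (request_history M N A t) (PiM ?I (\<lambda>_. ?C))"
  proof (rule measurable_restrict)
    fix x assume "x \<in> ?I"
    then show "(\<lambda>\<omega>. case x of (k, s) \<Rightarrow> card (A k \<omega> \<inter> {..s})) \<in> measurable (request_history M N A t) ?C"
      using assms by (cases x) (simp add: request_history_count)
  qed
  then show ?thesis
    unfolding request_history_def[of M N A s] by (intro sets_image_in_sets) auto
qed

lemma measurable_request_history_mono:
  assumes "f \<in> measurable (request_history M N A s) K" "s \<le> t"
  shows "f \<in> measurable (request_history M N A t) K"
proof (rule measurableI)
  show "f x \<in> space K" if "x \<in> space (request_history M N A t)" for x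
    using measurable_space[OF assms(1)] that by simp
  show "f -` B \<inter> space (request_history M N A t) \<in> sets (request_history M N A t)" if "B \<in> sets K" for B
    using measurable_sets[OF assms(1) that] request_history_mono[OF assms(2), of M N A] unfolding space_request_history by blast
qed

text \<open>A point of \<open>F\<close> strictly between \<open>y\<close> and \<open>t\<close> is
  detected by a rational between it and \<open>t\<close>, where the count has already jumped.
  Rational times make the event a countable intersection.\<close>

lemma no_points_iff_count:
  assumes F: "locally_finite F" and "0 \<le> y" "y < t"
  shows "(\<forall>x\<in>F. 0 \<le> x \<and> x < t \<longrightarrow> x \<le> y) \<longleftrightarrow>
    (\<forall>q\<in>\<rat> \<inter> {y..<t}. card {x\<in>{0..q}. x \<in> F} = card {x\<in>{0..y}. x \<in> F})"
proof
  assume none: "\<forall>x\<in>F. 0 \<le> x \<and> x < t \<longrightarrow> x \<le> y"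
  then have "{x\<in>{0..q}. x \<in> F} = {x\<in>{0..y}. x \<in> F}" if "q \<in> \<rat> \<inter> {y..<t}" for q
    using that by force
  then show "\<forall>q\<in>\<rat> \<inter> {y..<t}. card {x\<in>{0..q}. x \<in> F} = card {x\<in>{0..y}. x \<in> F}" by simp
next
  assume eq: "\<forall>q\<in>\<rat> \<inter> {y..<t}. card {x\<in>{0..q}. x \<in> F} = card {x\<in>{0..y}. x \<in> F}"
  show "\<forall>x\<in>F. 0 \<le> x \<and> x < t \<longrightarrow> x \<le> y"
  proof (intro ballI impI, rule ccontr)
    fix x assume x: "x \<in> F" "0 \<le> x \<and> x < t" "\<not> x \<le> y"
    obtain q where q: "q \<in> \<rat>" "x < q" "q < t" using Rats_dense_in_real x(2) by blast
    have "{x\<in>{0..y}. x \<in> F} \<subset> {x\<in>{0..q}. x \<in> F}"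
    proof (rule psubsetI)
      show "{x\<in>{0..y}. x \<in> F} \<subseteq> {x\<in>{0..q}. x \<in> F}" using q x by auto
      show "{x\<in>{0..y}. x \<in> F} \<noteq> {x\<in>{0..q}. x \<in> F}" using q x by fastforce
    qed
    then have "card {x\<in>{0..y}. x \<in> F} < card {x\<in>{0..q}. x \<in> F}"
      using F by (intro psubset_card_mono) (auto simp: locally_finite_def)
    then show False using eq q x by auto
  qed
qed

text \<open>A level set of the age compares fetch counts at rational times before \<open>t\<close>,
  each measurable by adaptedness. This makes \<open>compensated_requests_expectation\<close>
  available for every admissible policy.\<close>

lemma age_measurable:
  assumes F: "\<And>\<omega>. \<omega> \<in> space M \<Longrightarrow> locally_finite (F \<omega>)"
    and count: "\<And>s. 0 \<le> s \<Longrightarrow> (\<lambda>\<omega>. card {x\<in>{0..s}. x \<in> F \<omega>}) \<in> measurable (request_history M N A s) (count_space UNIV)"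
    and t: "0 \<le> t"
  shows "(\<lambda>\<omega>. age (F \<omega>) t) \<in> borel_measurable (request_history M N A t)"
proof (subst borel_measurable_iff_ge, rule allI)
  fix a
  let ?H = "request_history M N A t"
  define y where "y = t - a"
  have a: "a = t - y" by (simp add: y_def)
  \<comment> \<open>The age lies between 0 and \<open>t\<close>, so the first two cases give the
    whole space and the empty set.\<close>
  consider "t \<le> y" | "y < 0" | "0 \<le> y" "y < t" by linarith
  then show "{\<omega> \<in> space ?H. a \<le> age (F \<omega>) t} \<in> sets ?H"
  proof cases
    case 1
    then have "{\<omega> \<in> space ?H. a \<le> age (F \<omega>) t} = space ?H"
      using age_nonneg[OF F t] unfolding a by force
    then show ?thesis by (metis sets.top)
  next
    case 2
    then have "{\<omega> \<in> space ?H. a \<le> age (F \<omega>) t} = {}"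
      using age_le[OF F, of _ t] unfolding a by force
    then show ?thesis by (metis sets.empty_sets)
  next
    case 3
    let ?c = "\<lambda>s \<omega>. card {x\<in>{0..s}. x \<in> F \<omega>}"
    have c: "?c s \<in> measurable ?H (count_space UNIV)" if "0 \<le> s" "s \<le> t" for s
      using measurable_request_history_mono[OF count] that by blast
    have "{\<omega> \<in> space ?H. a \<le> age (F \<omega>) t} = {\<omega> \<in> space ?H. \<forall>q\<in>\<rat> \<inter> {y..<t}. ?c q \<omega> = ?c y \<omega>}"
      using age_ge_iff[OF F 3(1)] no_points_iff_count[OF F 3] unfolding a by auto
    also have "\<dots> \<in> sets ?H"
    proof (rule sets.sets_Collect_countable_All')
      show "countable (\<rat> \<inter> {y..<t})" using countable_rat by blast
      show "{\<omega> \<in> space ?H. ?c q \<omega> = ?c y \<omega>} \<in> sets ?H" if "q \<in> \<rat> \<inter> {y..<t}" for q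
      proof -
        have "0 \<le> q" "q \<le> t" using that 3 by auto
        then have "(\<lambda>\<omega>. ?c q \<omega> = ?c y \<omega>) \<in> measurable ?H (count_space UNIV)"
          using 3 by (intro measurable_countable_op2[where h="(=)", OF c c]) auto
        then show ?thesis by (simp add: pred_def)
      qed
    qed
    finally show ?thesis .
  qed
qed

section \<open>Existence and adaptedness of the threshold policy along a path\<close>

definition follows_threshold :: "real \<Rightarrow> real set \<Rightarrow> real set \<Rightarrow> bool" where
  "follows_threshold \<tau> A F \<longleftrightarrow> (\<forall>t\<ge>0. t \<in> F \<longleftrightarrow> t \<in> A \<and> \<tau> < age F t)"

lemma follows_threshold_locally_finite:
  assumes "follows_threshold \<tau> A F" "\<And>T. finite (A \<inter> {..T})"
  shows "locally_finite F"
  unfolding locally_finite_def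
proof
  fix T
  show "finite {t\<in>{0..T}. t \<in> F}"
    by (rule finite_subset[OF _ assms(2)[of T]]) (use assms(1) in \<open>auto simp: follows_threshold_def\<close>)
qed

text \<open>Fetches occur only at requests, and the decision at a request depends on the decisions
  at earlier ones, so the fixed point is a recursion along the requests. It is well-founded because
  the number of requests up to a given time is finite and serves as a rank.\<close>

lemma follows_threshold_exists:
  assumes "\<And>T. finite (A \<inter> {..T::real})"
  shows "\<exists>F. follows_threshold \<tau> A F"
proof -
  define R where "R = {(x, y). x \<in> A \<and> y \<in> A \<and> x < y}"
  have "wf R"
  proof (rule wf_subset[OF wf_inv_image[OF wf_less_than]])
    show "R \<subseteq> inv_image less_than (\<lambda>x. card (A \<inter> {..x}))"
    proof
      fix z assume "z \<in> R"
      then obtain x y where z: "z = (x, y)" "x \<in> A" "y \<in> A" "x < y" by (auto simp: R_def)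
      have "A \<inter> {..x} \<subset> A \<inter> {..y}" using z by force
      then show "z \<in> inv_image less_than (\<lambda>x. card (A \<inter> {..x}))"
        using z(1) assms by (simp add: psubset_card_mono)
    qed
  qed
  \<comment> \<open>Restricting to points of \<open>A\<close> makes \<open>\<Phi>\<close> consult
    \<open>f\<close> only at predecessors under \<open>R\<close>, where \<open>cut\<close> leaves
    the recursive function unchanged.\<close>
  define \<Phi> where "\<Phi> f t \<longleftrightarrow> t \<in> A \<and> \<tau> < t - Max (insert 0 {x\<in>{0..<t}. x \<in> A \<and> f x})" for f t
  define F where "F = Collect (wfrec R \<Phi>)"
  have F: "t \<in> F \<longleftrightarrow> \<Phi> (cut (wfrec R \<Phi>) R t) t" for t
    unfolding F_def mem_Collect_eq by (subst wfrec[OF \<open>wf R\<close>]) simp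
  then have sub: "F \<subseteq> A" by (auto simp: \<Phi>_def)
  have "t \<in> F \<longleftrightarrow> t \<in> A \<and> \<tau> < age F t" for t
  proof (cases "t \<in> A")
    case True
    then have "{x\<in>{0..<t}. x \<in> A \<and> cut (wfrec R \<Phi>) R t x} = {x\<in>{0..<t}. x \<in> F}"
      using sub by (auto simp: cut_def R_def F_def)
    then show ?thesis unfolding F \<Phi>_def age_def by simp
  qed (use sub in auto)
  then show ?thesis unfolding follows_threshold_def by blast
qed

text \<open>
  The \<open>k+1\<close>st fetch is the first request later than \<open>\<tau>\<close> after the \<open>k\<close>th one. The rational \<open>q\<close> separates
  the end of this waiting period from the request, so that adaptedness follows by induction on \<open>k\<close>
  without introducing stopping times.
\<close>

lemma follows_threshold_count_iff:
  assumes F: "follows_threshold \<tau> A F" and A: "A \<subseteq> {0<..}" "\<And>T. finite (A \<inter> {..T})"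
    and \<tau>: "0 \<le> \<tau>" and t: "0 \<le> t"
  shows "Suc k \<le> card {x\<in>{0..t}. x \<in> F} \<longleftrightarrow>
    (\<exists>q\<in>\<rat> \<inter> {\<tau>..<t}. k \<le> card {x\<in>{0..q - \<tau>}. x \<in> F} \<and> card (A \<inter> {..q}) < card (A \<inter> {..t}))"
    (is "?lhs \<longleftrightarrow> ?rhs")
proof
  have lf: "locally_finite F" using follows_threshold_locally_finite[OF F A(2)] .
  have fin: "finite {x\<in>{0..s}. x \<in> F}" for s using lf by (simp add: locally_finite_def)
  have rule: "s \<in> F \<longleftrightarrow> s \<in> A \<and> \<tau> < age F s" if "0 \<le> s" for s
    using F that by (simp add: follows_threshold_def)
  {
    assume ?lhs
    then have "0 < card {x\<in>{0..t}. x \<in> F}" by linarith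
    then have ne: "{x\<in>{0..t}. x \<in> F} \<noteq> {}" by (metis card.empty less_irrefl)
    define f where "f = Max {x\<in>{0..t}. x \<in> F}"
    have f: "f \<in> F" "0 \<le> f" "f \<le> t" using Max_in[OF fin ne] by (auto simp: f_def)
    have fA: "f \<in> A" "\<tau> < age F f" using rule[OF f(2)] f(1) by auto
    obtain g where g: "0 \<le> g" "age F f = f - g" "\<And>x. x \<in> F \<Longrightarrow> 0 \<le> x \<Longrightarrow> x < f \<Longrightarrow> x \<le> g"
      using age_last[OF lf f(2)] by metis
    \<comment> \<open>\<open>f\<close> is the last fetch up to \<open>t\<close> and \<open>g\<close>
      bounds all earlier ones. With \<open>q\<close> between g + \<tau> and \<open>f\<close>, every
      fetch up to \<open>t\<close> other than \<open>f\<close> happens by time q - \<tau>.\<close>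
    obtain q where q: "q \<in> \<rat>" "g + \<tau> < q" "q < f"
      using Rats_dense_in_real[of "g + \<tau>" f] fA(2) g(2) by auto
    have "{x\<in>{0..t}. x \<in> F} \<subseteq> insert f {x\<in>{0..q - \<tau>}. x \<in> F}"
    proof
      fix x assume x: "x \<in> {x\<in>{0..t}. x \<in> F}"
      then have "x \<le> f" unfolding f_def by (rule Max_ge[OF fin])
      then show "x \<in> insert f {x\<in>{0..q - \<tau>}. x \<in> F}" using g(3)[of x] x q by force
    qed
    then have "card {x\<in>{0..t}. x \<in> F} \<le> card (insert f {x\<in>{0..q - \<tau>}. x \<in> F})"
      by (intro card_mono finite.insertI fin)
    also have "\<dots> \<le> Suc (card {x\<in>{0..q - \<tau>}. x \<in> F})" by (rule card_insert_le_m1) auto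
    finally have "k \<le> card {x\<in>{0..q - \<tau>}. x \<in> F}" using \<open>?lhs\<close> by simp
    moreover have "card (A \<inter> {..q}) < card (A \<inter> {..t})"
    proof (rule psubset_card_mono[OF A(2)])
      have "f \<in> A \<inter> {..t}" "f \<notin> A \<inter> {..q}" using fA f q by auto
      moreover have "A \<inter> {..q} \<subseteq> A \<inter> {..t}" using q f by auto
      ultimately show "A \<inter> {..q} \<subset> A \<inter> {..t}" by blast
    qed
    moreover have "q \<in> \<rat> \<inter> {\<tau>..<t}" using q g(1) f by auto
    ultimately show ?rhs by blast
  }
  assume ?rhs
  then obtain q where q: "q \<in> \<rat>" "\<tau> \<le> q" "q < t" and k: "k \<le> card {x\<in>{0..q - \<tau>}. x \<in> F}"
    and less: "card (A \<inter> {..q}) < card (A \<inter> {..t})" by auto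
  have "\<not> A \<inter> {..t} \<subseteq> A \<inter> {..q}" using card_mono[OF A(2)[of q]] less by (metis not_le)
  then obtain x where "x \<in> A" "x \<le> t" "\<not> x \<le> q" by blast
  then have x: "x \<in> A" "x \<le> t" "q < x" by auto
  \<comment> \<open>If no fetch occurred after q - \<tau>, the request \<open>x\<close> would find
    an age above \<tau> and would itself be a fetch.\<close>
  have "\<exists>f\<in>F. q - \<tau> < f \<and> f \<le> t"
  proof (rule ccontr)
    assume none: "\<not> (\<exists>f\<in>F. q - \<tau> < f \<and> f \<le> t)"
    have "x - (q - \<tau>) \<le> age F x"
      using q x none by (subst age_ge_iff[OF lf]) force+
    then have "x \<in> F" using rule[of x] x q \<tau> by auto
    then show False using none x q \<tau> by auto
  qed
  then obtain f where f: "f \<in> F" "q - \<tau> < f" "f \<le> t" by blast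
  have "Suc (card {x\<in>{0..q - \<tau>}. x \<in> F}) = card (insert f {x\<in>{0..q - \<tau>}. x \<in> F})"
    using f by (subst card_insert_disjoint[OF fin]) auto
  also have "\<dots> \<le> card {x\<in>{0..t}. x \<in> F}"
    by (rule card_mono[OF fin]) (use f q \<tau> in auto)
  finally show ?lhs using k by simp
qed

text \<open>The induction on \<open>k\<close> keeps \<open>t\<close> arbitrary, because the event
  for k+1 at time \<open>t\<close> refers to the event for \<open>k\<close> at the times q - \<tau>.
  Differences of consecutive level sets then give the preimages of points.\<close>

lemma follows_threshold_count_measurable:
  assumes n: "n \<in> {1..N}"
    and F: "\<And>\<omega>. \<omega> \<in> space M \<Longrightarrow> follows_threshold \<tau> (A n \<omega>) (F \<omega>)"
    and A: "\<And>\<omega>. \<omega> \<in> space M \<Longrightarrow> A n \<omega> \<subseteq> {0<..}" "\<And>\<omega> T. \<omega> \<in> space M \<Longrightarrow> finite (A n \<omega> \<inter> {..T})"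
    and \<tau>: "0 \<le> \<tau>" and t: "0 \<le> t"
  shows "(\<lambda>\<omega>. card {x\<in>{0..t}. x \<in> F \<omega>}) \<in> measurable (request_history M N A t) (count_space UNIV)"
proof -
  let ?c = "\<lambda>s \<omega>. card {x\<in>{0..s}. x \<in> F \<omega>}"
  have ge: "{\<omega>\<in>space M. k \<le> ?c t \<omega>} \<in> sets (request_history M N A t)" if "0 \<le> t" for k t
    using that
  proof (induction k arbitrary: t)
    case 0
    then show ?case using sets.top[of "request_history M N A t"] by simp
  next
    case (Suc k)
    let ?H = "request_history M N A t"
    let ?P = "\<lambda>q \<omega>. k \<le> ?c (q - \<tau>) \<omega> \<and> card (A n \<omega> \<inter> {..q}) < card (A n \<omega> \<inter> {..t})"
    have "Suc k \<le> ?c t \<omega> \<longleftrightarrow> (\<exists>q\<in>\<rat> \<inter> {\<tau>..<t}. ?P q \<omega>)" if "\<omega> \<in> space M" for \<omega>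
      by (rule follows_threshold_count_iff[OF F[OF that] A(1)[OF that] A(2)[OF that] \<tau> Suc.prems])
    then have "{\<omega>\<in>space M. Suc k \<le> ?c t \<omega>} = {\<omega>\<in>space ?H. \<exists>q\<in>\<rat> \<inter> {\<tau>..<t}. ?P q \<omega>}"
      unfolding space_request_history by blast
    also have "\<dots> \<in> sets ?H"
    proof (rule sets.sets_Collect_countable_Ex')
      show "countable (\<rat> \<inter> {\<tau>..<t})" using countable_rat by blast
      fix q assume "q \<in> \<rat> \<inter> {\<tau>..<t}"
      then have q: "0 \<le> q - \<tau>" "q - \<tau> \<le> t" "0 \<le> q" "q \<le> t" using \<tau> by auto
      have "{\<omega>\<in>space ?H. k \<le> ?c (q - \<tau>) \<omega>} \<in> sets ?H"
        using Suc.IH[OF q(1)] request_history_mono[OF q(2)] by auto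
      moreover have "(\<lambda>\<omega>. card (A n \<omega> \<inter> {..q}) < card (A n \<omega> \<inter> {..t})) \<in> measurable ?H (count_space UNIV)"
        using q Suc.prems n
        by (intro measurable_countable_op2[where h="(<)", OF request_history_count request_history_count]) auto
      ultimately show "{\<omega>\<in>space ?H. ?P q \<omega>} \<in> sets ?H"
        by (intro sets.sets_Collect_conj) (simp_all add: pred_def)
    qed
    finally show ?case .
  qed
  show ?thesis
    unfolding measurable_count_space_eq2_countable
  proof (intro conjI ballI)
    fix k :: nat
    have "?c t -` {k} \<inter> space M = {\<omega>\<in>space M. k \<le> ?c t \<omega>} - {\<omega>\<in>space M. Suc k \<le> ?c t \<omega>}"
      by auto
    then show "?c t -` {k} \<inter> space (request_history M N A t) \<in> sets (request_history M N A t)"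
      unfolding space_request_history by (simp only: sets.Diff ge[OF t])
  qed simp
qed

section \<open>Optimality of the threshold policy\<close>

lemma total_cost_path_cost:
  "total_cost N cf ca lam A u T \<omega> =
    (\<Sum>n = 1..N. path_cost cf (lam n * ca) (A n \<omega>) {t. u n t \<omega>} T)"
  by (simp add: total_cost_def path_cost_def fetch_count_def since_fetch_age)

section \<open>The threshold as the positive root of a quadratic equation\<close>

lemma fetch_threshold_pos:
  assumes "0 < \<beta> * p n" "0 < cf" "0 < ca * lam n"
  shows "0 < fetch_threshold \<beta> p cf ca lam n"
proof -
  have "0 < 2 * (\<beta> * p n) * cf / (ca * lam n)" using assms by simp
  then show ?thesis using assms by (simp add: fetch_threshold_def mult.assoc)
qed

text \<open>With r = 1 + b \<tau> the quadratic a b \<tau>^2/2 + a \<tau> = cf becomes r^2 = 1 + 2 b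
  cf / a, and the square root in the threshold is this r.\<close>

lemma fetch_threshold_indifference:
  assumes "0 < \<beta> * p n" "0 < cf" "0 < ca * lam n"
  shows "cf = lam n * ca * (\<beta> * p n) * (fetch_threshold \<beta> p cf ca lam n)\<^sup>2 / 2 +
    lam n * ca * fetch_threshold \<beta> p cf ca lam n"
proof -
  define b where "b = \<beta> * p n"
  define a where "a = ca * lam n"
  define r where "r = sqrt (1 + 2 * b * cf / a)"
  have pos: "0 < a" "0 < b" using assms by (auto simp: a_def b_def)
  have r: "r\<^sup>2 = 1 + 2 * b * cf / a"
    unfolding r_def using pos assms by (intro real_sqrt_pow2) auto
  have \<tau>: "fetch_threshold \<beta> p cf ca lam n = 1 / b * (r - 1)"
    by (simp add: fetch_threshold_def r_def b_def a_def mult.assoc)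
  have "a * b * (1 / b * (r - 1))\<^sup>2 / 2 + a * (1 / b * (r - 1)) = a * (r\<^sup>2 - 1) / (2 * b)"
    using pos by (simp add: field_simps power2_eq_square)
  also have "\<dots> = cf" unfolding r using pos by (simp add: field_simps)
  finally show ?thesis unfolding \<tau> by (simp add: a_def b_def mult.commute)
qed

lemma fetch_threshold_cost:
  assumes "0 < \<beta> * p n" "0 < cf" "0 < ca" "0 < lam n"
  shows "lam n * ca * (\<beta> * p n) * fetch_threshold \<beta> p cf ca lam n =
    ca * lam n * (sqrt (1 + 2 * \<beta> * p n / lam n * (cf / ca)) - 1)"
proof -
  have "2 * \<beta> * p n * cf / (ca * lam n) = 2 * \<beta> * p n / lam n * (cf / ca)" by simp
  then show ?thesis
    using assms by (simp add: fetch_threshold_def)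
qed

text \<open>\<open>ennreal\<close> sends negative values to 0, so \<open>f\<close> is replaced by
  its positive part, which can only raise the integral. The comparison is one-sided because the cost
  of an arbitrary policy may have infinite expectation.\<close>

lemma has_bochner_integral_le_nn_integral:
  assumes "has_bochner_integral M f x" "\<And>\<omega>. \<omega> \<in> space M \<Longrightarrow> f \<omega> \<le> g \<omega>"
  shows "ennreal x \<le> (\<integral>\<^sup>+\<omega>. ennreal (g \<omega>) \<partial>M)"
proof -
  have f: "integrable M f" "integral\<^sup>L M f = x" using assms(1) by (auto simp: has_bochner_integral_iff)
  have "ennreal x \<le> ennreal (\<integral>\<omega>. max 0 (f \<omega>) \<partial>M)"
    unfolding f(2)[symmetric] using f(1) by (intro ennreal_leI integral_mono) auto
  also have "\<dots> = (\<integral>\<^sup>+\<omega>. ennreal (max 0 (f \<omega>)) \<partial>M)"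
    using f(1) by (intro nn_integral_eq_integral[symmetric]) auto
  also have "\<dots> \<le> (\<integral>\<^sup>+\<omega>. ennreal (g \<omega>) \<partial>M)"
    by (intro nn_integral_mono) (use assms(2) in \<open>auto simp: max_def ennreal_leI\<close>)
  finally show ?thesis .
qed

lemma nn_integral_le_has_bochner_integral:
  assumes "has_bochner_integral M f x" "\<And>\<omega>. \<omega> \<in> space M \<Longrightarrow> 0 \<le> f \<omega>"
    "\<And>\<omega>. \<omega> \<in> space M \<Longrightarrow> g \<omega> \<le> f \<omega>"
  shows "(\<integral>\<^sup>+\<omega>. ennreal (g \<omega>) \<partial>M) \<le> ennreal x"
proof -
  have "(\<integral>\<^sup>+\<omega>. ennreal (g \<omega>) \<partial>M) \<le> (\<integral>\<^sup>+\<omega>. ennreal (f \<omega>) \<partial>M)"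
    by (intro nn_integral_mono ennreal_leI assms(3))
  also have "\<dots> = ennreal x"
    using assms(1,2) by (subst nn_integral_eq_integral) (auto simp: has_bochner_integral_iff)
  finally show ?thesis .
qed

theorem theorem2:
  fixes M :: "'a measure"
    and N :: nat
    and \<beta> cf ca :: real
    and p lam :: "nat \<Rightarrow> real"
    and A :: "nat \<Rightarrow> 'a \<Rightarrow> real set"
  assumes "prob_space M"
    and "N \<ge> 1"
    and "\<beta> > 0" and "cf > 0" and "ca > 0"
    and "\<And>n. n \<in> {1..N} \<Longrightarrow> p n > 0"
    and "(\<Sum>n = 1..N. p n) = 1"
    and "\<And>n. n \<in> {1..N} \<Longrightarrow> lam n > 0"
    and "request_processes M N \<beta> p A"
  shows "(\<exists>u. follows_rule M N A (threshold_rule (fetch_threshold \<beta> p cf ca lam)) u) \<and>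
    (\<forall>u. follows_rule M N A (threshold_rule (fetch_threshold \<beta> p cf ca lam)) u \<longrightarrow>
       optimal_policy M N cf ca lam A u \<and>
       average_cost M N cf ca lam A u = optimal_cost M N cf ca lam A) \<and>
    optimal_cost M N cf ca lam A =
      ennreal (\<Sum>n = 1..N. ca * lam n * (sqrt (1 + 2 * \<beta> * p n / lam n * (cf / ca)) - 1))"
proof -
  interpret prob_space M by fact
  define b where "b n = \<beta> * p n" for n
  define a where "a n = lam n * ca" for n
  define \<tau> where "\<tau> = fetch_threshold \<beta> p cf ca lam"
  define g where "g = (\<Sum>n = 1..N. a n * b n * \<tau> n)"
  \<comment> \<open>\<open>C\<close> collects the boundary terms of the pathwise lower bounds. It is
    independent of the horizon and vanishes in the average.\<close>
  define C where "C = (\<Sum>n = 1..N. a n * b n * (\<tau> n)\<^sup>2 / 2)"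
  have b: "0 < b n" and a: "0 < a n" if "n \<in> {1..N}" for n
    using assms that by (auto simp: a_def b_def)
  have a': "0 < ca * lam n" if "n \<in> {1..N}" for n using a[OF that] by (simp add: a_def mult.commute)
  have \<tau>: "0 < \<tau> n" if "n \<in> {1..N}" for n
    unfolding \<tau>_def using b a' assms(4) that by (intro fetch_threshold_pos) (auto simp: b_def)
  have cf: "cf = a n * b n * (\<tau> n)\<^sup>2 / 2 + a n * \<tau> n" if "n \<in> {1..N}" for n
    unfolding \<tau>_def a_def b_def using b a' assms(4) that
    by (intro fetch_threshold_indifference) (auto simp: b_def)
  have g_eq: "g = (\<Sum>n = 1..N. ca * lam n * (sqrt (1 + 2 * \<beta> * p n / lam n * (cf / ca)) - 1))"
    unfolding g_def a_def b_def \<tau>_def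
    using assms by (intro sum.cong[OF refl] fetch_threshold_cost) auto
  have pp: "poisson_process M (b n) (A n)" if "n \<in> {1..N}" for n
    using assms(9) that by (simp add: request_processes_def b_def)
  note A = poisson_process_finite[OF pp]

  have lf: "locally_finite {t. v n t \<omega>}" if "admissible M N A v" "n \<in> {1..N}" "\<omega> \<in> space M" for v n \<omega>
    using that by (auto simp: admissible_def locally_finite_def)
  define D where "D v T n \<omega> = compensated_requests (b n) (\<tau> n) (A n \<omega>) {t. v n t \<omega>} T"
    for v :: "'a policy" and T n \<omega>
  have D: "has_bochner_integral M (D v T n) 0" if v: "admissible M N A v" and T: "0 < T" and n: "n \<in> {1..N}" for v T n
    unfolding D_def b_def
  proof (rule compensated_requests_expectation[OF assms(9) n _ lf[OF v n] _ T])
    show "0 < \<beta> * p n" "0 \<le> \<tau> n" using b[OF n] \<tau>[OF n] by (auto simp: b_def)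
    show "(\<lambda>\<omega>. age {t. v n t \<omega>} t) \<in> borel_measurable (request_history M N A t)" if "0 \<le> t" for t
    proof (rule age_measurable[OF lf[OF v n] _ that])
      show "(\<lambda>\<omega>. card {x\<in>{0..s}. x \<in> {t. v n t \<omega>}}) \<in> measurable (request_history M N A s) (count_space UNIV)"
        if "0 \<le> s" for s
        using v n that by (simp add: admissible_def fetch_count_def[abs_def])
    qed
  qed
  have bochner: "has_bochner_integral M (\<lambda>\<omega>. x + (\<Sum>n = 1..N. a n * D v T n \<omega>)) x"
    if "admissible M N A v" "0 < T" for v T x
  proof -
    have "has_bochner_integral M (\<lambda>\<omega>. \<Sum>n = 1..N. a n * D v T n \<omega>) (\<Sum>n = 1..N. a n * 0)"
      by (intro has_bochner_integral_sum has_bochner_integral_mult_right D that)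
    moreover have "has_bochner_integral M (\<lambda>\<omega>. x) x"
      by (simp add: has_bochner_integral_iff prob_space)
    ultimately show ?thesis using has_bochner_integral_add by fastforce
  qed

  have lower: "ennreal g \<le> average_cost M N cf ca lam A v" if v: "admissible M N A v" for v
  proof -
    have "\<forall>\<^sub>F T in at_top. ennreal (g - C / T) \<le>
        ennreal (1 / T) * (\<integral>\<^sup>+\<omega>. ennreal (total_cost N cf ca lam A v T \<omega>) \<partial>M)"
      using eventually_gt_at_top[of 0]
    proof eventually_elim
      case (elim T)
      have "ennreal (g * T - C) \<le> (\<integral>\<^sup>+\<omega>. ennreal (total_cost N cf ca lam A v T \<omega>) \<partial>M)"
      proof (rule has_bochner_integral_le_nn_integral[OF bochner[OF v elim]])
        fix \<omega> assume \<omega>: "\<omega> \<in> space M"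
        have "g * T - C + (\<Sum>n = 1..N. a n * D v T n \<omega>) =
            (\<Sum>n = 1..N. a n * b n * \<tau> n * T - a n * b n * (\<tau> n)\<^sup>2 / 2 + a n * D v T n \<omega>)"
          by (simp add: g_def C_def sum.distrib sum_subtractf sum_distrib_right)
        also have "\<dots> \<le> total_cost N cf ca lam A v T \<omega>"
          unfolding total_cost_path_cost D_def a_def[symmetric]
          using \<omega> elim a b \<tau> lf[OF v] A cf
          by (intro sum_mono path_cost_ge) (auto intro: less_imp_le)
        finally show "g * T - C + (\<Sum>n = 1..N. a n * D v T n \<omega>) \<le> total_cost N cf ca lam A v T \<omega>" .
      qed
      then have "ennreal (1 / T) * ennreal (g * T - C) \<le>
          ennreal (1 / T) * (\<integral>\<^sup>+\<omega>. ennreal (total_cost N cf ca lam A v T \<omega>) \<partial>M)"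
        by (rule mult_left_mono) simp
      \<comment> \<open>For small \<open>T\<close> the value g T - C may be negative; both sides are
        then 0.\<close>
      moreover have "ennreal (1 / T) * ennreal (g * T - C) = ennreal (g - C / T)"
      proof -
        have "ennreal (1 / T) * ennreal (g * T - C) = ennreal (1 / T * (g * T - C))"
          using elim by (intro ennreal_mult'[symmetric]) simp
        also have "1 / T * (g * T - C) = g - C / T" using elim by (simp add: field_simps)
        finally show ?thesis .
      qed
      ultimately show ?case by simp
    qed
    then have "Limsup at_top (\<lambda>T. ennreal (g - C / T)) \<le> average_cost M N cf ca lam A v"
      unfolding average_cost_def by (rule Limsup_mono)
    moreover have "((\<lambda>T. ennreal (g - C / T)) \<longlongrightarrow> ennreal (g - 0)) at_top"
      by (intro tendsto_ennrealI tendsto_diff tendsto_const tendsto_divide_0[OF tendsto_const]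
          filterlim_at_top_imp_at_infinity filterlim_ident)
    then have "Limsup at_top (\<lambda>T. ennreal (g - C / T)) = ennreal g"
      by (intro lim_imp_Limsup) auto
    ultimately show ?thesis by simp
  qed

  let ?follows = "follows_rule M N A (threshold_rule (fetch_threshold \<beta> p cf ca lam))"
  have follows: "?follows u \<longleftrightarrow>
      (\<forall>n\<in>{1..N}. \<forall>\<omega>\<in>space M. follows_threshold (\<tau> n) (A n \<omega>) {t. u n t \<omega>})" for u
  proof -
    have "threshold_rule \<tau> n s r \<longleftrightarrow> r \<and> \<tau> n < s" for n s r by (simp add: threshold_rule_def)
    then show ?thesis
      by (simp add: follows_rule_def follows_threshold_def since_fetch_age \<tau>_def)
  qed
  have admissible: "admissible M N A u" if u: "?follows u" for u
    unfolding admissible_def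
  proof (intro ballI conjI allI impI)
    fix n assume n: "n \<in> {1..N}"
    have th: "follows_threshold (\<tau> n) (A n \<omega>) {t. u n t \<omega>}" if "\<omega> \<in> space M" for \<omega>
      using u n that follows by blast
    show "finite {t \<in> {0..T}. u n t \<omega>}" if "\<omega> \<in> space M" for \<omega> T
      using follows_threshold_locally_finite[OF th[OF that] A(2)[OF n that]]
      by (simp add: locally_finite_def)
    show "fetch_count u n t \<in> measurable (request_history M N A t) (count_space UNIV)" if "0 \<le> t" for t
      using follows_threshold_count_measurable
        [where F="\<lambda>\<omega>. {t. u n t \<omega>}" and A=A and M=M, OF n th A[OF n] less_imp_le[OF \<tau>[OF n]] that]
      by (simp add: fetch_count_def[abs_def])
  qed
  \<comment> \<open>The pathwise upper bound for the threshold rule has no boundary term, so the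
    average is at most \<open>g\<close> at every positive horizon.\<close>
  have upper: "average_cost M N cf ca lam A u \<le> ennreal g" if u: "?follows u" for u
    unfolding average_cost_def
  proof (rule Limsup_bounded)
    show "\<forall>\<^sub>F T in at_top. ennreal (1 / T) * (\<integral>\<^sup>+\<omega>. ennreal (total_cost N cf ca lam A u T \<omega>) \<partial>M) \<le> ennreal g"
      using eventually_gt_at_top[of 0]
    proof eventually_elim
      case (elim T)
      have le: "total_cost N cf ca lam A u T \<omega> \<le> g * T + (\<Sum>n = 1..N. a n * D u T n \<omega>)"
        if \<omega>: "\<omega> \<in> space M" for \<omega>
      proof -
        have "total_cost N cf ca lam A u T \<omega> \<le> (\<Sum>n = 1..N. a n * b n * \<tau> n * T + a n * D u T n \<omega>)"
          unfolding total_cost_path_cost D_def a_def[symmetric]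
        proof (intro sum_mono path_cost_le)
          fix n t assume n: "n \<in> {1..N}" and t: "(0::real) \<le> t"
          then show "t \<in> {t. u n t \<omega>} \<longleftrightarrow> t \<in> A n \<omega> \<and> \<tau> n < age {t. u n t \<omega>} t"
            using u \<omega> unfolding follows follows_threshold_def by blast
        qed (use \<omega> elim a b \<tau> lf[OF admissible[OF u]] A cf in \<open>auto intro: less_imp_le\<close>)
        also have "\<dots> = g * T + (\<Sum>n = 1..N. a n * D u T n \<omega>)"
          by (simp add: g_def sum.distrib sum_distrib_right)
        finally show ?thesis .
      qed
      \<comment> \<open>The comparison of integrals asks for a nonnegative majorant; its sign is
        inherited from the cost that it dominates.\<close>
      have nonneg: "0 \<le> total_cost N cf ca lam A u T \<omega>" if \<omega>: "\<omega> \<in> space M" for \<omega>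
        unfolding total_cost_path_cost path_cost_def a_def[symmetric]
      proof (intro sum_nonneg add_nonneg_nonneg mult_nonneg_nonneg)
        fix n t assume n: "n \<in> {1..N}" and t: "t \<in> A n \<omega> \<inter> {..T}"
        then show "0 \<le> age {t. u n t \<omega>} t"
          using A(1)[OF n \<omega>] by (intro age_nonneg[OF lf[OF admissible[OF u] n \<omega>]]) auto
      qed (use assms(4) a in \<open>auto intro: less_imp_le\<close>)
      have "(\<integral>\<^sup>+\<omega>. ennreal (total_cost N cf ca lam A u T \<omega>) \<partial>M) \<le> ennreal (g * T)"
        using le nonneg
        by (intro nn_integral_le_has_bochner_integral[OF bochner[OF admissible[OF u] elim]])
           (auto intro: order_trans)
      then have "ennreal (1 / T) * (\<integral>\<^sup>+\<omega>. ennreal (total_cost N cf ca lam A u T \<omega>) \<partial>M) \<le>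
          ennreal (1 / T) * ennreal (g * T)"
        by (rule mult_left_mono) simp
      also have "\<dots> = ennreal g"
        using elim by (simp add: ennreal_mult'[symmetric])
      finally show ?case .
    qed
  qed

  obtain u\<^sub>0 where u\<^sub>0: "?follows u\<^sub>0"
  proof -
    \<comment> \<open>Fetch sets are chosen separately for each item and outcome. Adaptedness does
      not depend on how they are chosen, since \<open>admissible\<close> derives it from the
      rule.\<close>
    have "\<exists>F. follows_threshold (\<tau> n) (A n \<omega>) F" if "n \<in> {1..N}" "\<omega> \<in> space M" for n \<omega>
      using A(2)[OF that] by (rule follows_threshold_exists)
    then obtain F where "\<And>n \<omega>. n \<in> {1..N} \<Longrightarrow> \<omega> \<in> space M \<Longrightarrow> follows_threshold (\<tau> n) (A n \<omega>) (F n \<omega>)"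
      by metis
    then have "?follows (\<lambda>n t \<omega>. t \<in> F n \<omega>)" unfolding follows by simp
    then show ?thesis by (rule that)
  qed
  have avg: "average_cost M N cf ca lam A u = ennreal g" if "?follows u" for u
    using upper[OF that] lower[OF admissible[OF that]] by (rule antisym)
  have cost: "optimal_cost M N cf ca lam A = ennreal g"
    unfolding optimal_cost_def
  proof (rule antisym)
    show "(INF v\<in>Collect (admissible M N A). average_cost M N cf ca lam A v) \<le> ennreal g"
      by (rule INF_lower2[of u\<^sub>0]) (use admissible[OF u\<^sub>0] avg[OF u\<^sub>0] in auto)
    show "ennreal g \<le> (INF v\<in>Collect (admissible M N A). average_cost M N cf ca lam A v)"
      by (rule INF_greatest) (use lower in auto)
  qed
  have "optimal_policy M N cf ca lam A u" if "?follows u" for u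
    unfolding optimal_policy_def using admissible[OF that] lower avg[OF that] by simp
  with u\<^sub>0 avg cost show ?thesis unfolding g_eq by auto
qed

end
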